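(* Let $\Phi$ be an entanglement breaking channel and let $\Omega$ be an arbitrary channel (completely positive trace-preserving map between finite-dimensional matrix algebras). Then for every $p \geq 1$, $$\nu_p(\Phi \otimes \Omega) = \nu_p(\Phi)\,\nu_p(\Omega).$$
   Context: An entanglement breaking channel is a map of the form $\Phi(\rho) = \sum_{k=1}^K R_k \,\mathrm{Tr}(X_k \rho)$, where each $R_k$ is a density matrix (positive semidefinite, trace one) and $\{X_k\}$ is a POVM, i.e. $X_k \geq 0$ and $\sum_k X_k = I$. For a matrix $A$ and $p \geq 1$, $\|A\|_p = (\mathrm{Tr}|A|^p)^{1/p}$. The maximal $p$-norm of a channel $\Omega$ is $\nu_p(\Omega) = \sup_\rho \|\Omega(\rho)\|_p$, the supremum over density matrices $\rho$ in the domain of $\Omega$. *)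

theory Defs
  imports "Jordan_Normal_Form.Char_Poly"
begin

definition mtrace :: "complex mat \<Rightarrow> complex" where
  "mtrace A = (\<Sum>i<dim_row A. A $$ (i, i))"

definition cadj :: "complex mat \<Rightarrow> complex mat" where
  "cadj A = mat (dim_col A) (dim_row A) (\<lambda>(i, j). cnj (A $$ (j, i)))"

definition psd :: "nat \<Rightarrow> complex mat \<Rightarrow> bool" where
  "psd n A \<longleftrightarrow> A \<in> carrier_mat n n \<and> cadj A = A \<and>
     (\<forall>v \<in> carrier_vec n. Im (conjugate v \<bullet> (A *\<^sub>v v)) = 0
                          \<and> Re (conjugate v \<bullet> (A *\<^sub>v v)) \<ge> 0)"

definition density :: "nat \<Rightarrow> complex mat \<Rightarrow> bool" where
  "density n \<rho> \<longleftrightarrow> psd n \<rho> \<and> mtrace \<rho> = 1"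

text \<open>Kronecker (tensor) product of matrices; row index (i,k) is encoded as i * n2 + k.\<close>
definition kron :: "complex mat \<Rightarrow> complex mat \<Rightarrow> complex mat" where
  "kron A B = mat (dim_row A * dim_row B) (dim_col A * dim_col B)
     (\<lambda>(i, j). A $$ (i div dim_row B, j div dim_col B) * B $$ (i mod dim_row B, j mod dim_col B))"

definition munit :: "nat \<Rightarrow> nat \<Rightarrow> nat \<Rightarrow> complex mat" where
  "munit n i j = mat n n (\<lambda>(a, b). if a = i \<and> b = j then 1 else 0)"

text \<open>Tensor product of linear maps Phi : M_n1 -> M_m1 and Omega : M_n2 -> M_m2,
  the unique linear map with (Phi (x) Omega)(A (x) B) = Phi A (x) Omega B, written out
  via the matrix units: X = sum X_{(i,k),(j,l)} E_ij (x) E_kl.\<close>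
definition tensor_map ::
  "nat \<Rightarrow> nat \<Rightarrow> nat \<Rightarrow> nat \<Rightarrow> (complex mat \<Rightarrow> complex mat) \<Rightarrow> (complex mat \<Rightarrow> complex mat)
     \<Rightarrow> complex mat \<Rightarrow> complex mat" where
  "tensor_map n1 m1 n2 m2 \<Phi> \<Omega> X =
     mat (m1 * m2) (m1 * m2) (\<lambda>(a, b).
       \<Sum>i<n1. \<Sum>j<n1. \<Sum>k<n2. \<Sum>l<n2.
         X $$ (i * n2 + k, j * n2 + l) * kron (\<Phi> (munit n1 i j)) (\<Omega> (munit n2 k l)) $$ (a, b))"

definition linear_mmap :: "nat \<Rightarrow> nat \<Rightarrow> (complex mat \<Rightarrow> complex mat) \<Rightarrow> bool" where
  "linear_mmap n m \<Phi> \<longleftrightarrow>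
     (\<forall>A \<in> carrier_mat n n. \<Phi> A \<in> carrier_mat m m) \<and>
     (\<forall>A \<in> carrier_mat n n. \<forall>B \<in> carrier_mat n n. \<Phi> (A + B) = \<Phi> A + \<Phi> B) \<and>
     (\<forall>c. \<forall>A \<in> carrier_mat n n. \<Phi> (c \<cdot>\<^sub>m A) = c \<cdot>\<^sub>m \<Phi> A)"

definition completely_positive :: "nat \<Rightarrow> nat \<Rightarrow> (complex mat \<Rightarrow> complex mat) \<Rightarrow> bool" where
  "completely_positive n m \<Phi> \<longleftrightarrow>
     (\<forall>k X. psd (k * n) X \<longrightarrow> psd (k * m) (tensor_map k k n m (\<lambda>A. A) \<Phi> X))"

definition trace_preserving :: "nat \<Rightarrow> (complex mat \<Rightarrow> complex mat) \<Rightarrow> bool" where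
  "trace_preserving n \<Phi> \<longleftrightarrow> (\<forall>A \<in> carrier_mat n n. mtrace (\<Phi> A) = mtrace A)"

definition channel :: "nat \<Rightarrow> nat \<Rightarrow> (complex mat \<Rightarrow> complex mat) \<Rightarrow> bool" where
  "channel n m \<Phi> \<longleftrightarrow> linear_mmap n m \<Phi> \<and> completely_positive n m \<Phi> \<and> trace_preserving n \<Phi>"

definition eb_channel :: "nat \<Rightarrow> nat \<Rightarrow> (complex mat \<Rightarrow> complex mat) \<Rightarrow> bool" where
  "eb_channel n m \<Phi> \<longleftrightarrow>
     (\<exists>(K::nat) R Xs.
        (\<forall>k<K. density m (R k) \<and> psd n (Xs k)) \<and>
        mat n n (\<lambda>(a, b). \<Sum>k<K. Xs k $$ (a, b)) = 1\<^sub>m n \<and>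
        (\<forall>\<rho> \<in> carrier_mat n n.
           \<Phi> \<rho> = mat m m (\<lambda>(a, b). \<Sum>k<K. R k $$ (a, b) * mtrace (Xs k * \<rho>))))"

text \<open>Schatten p-norm ||A||_p = (Tr |A|^p)^(1/p), |A| = (A^* A)^(1/2): Tr |A|^p is the sum,
  with algebraic multiplicity, of lambda^(p/2) over the eigenvalues lambda of A^* A
  (roots of its characteristic polynomial).\<close>
definition schatten :: "real \<Rightarrow> complex mat \<Rightarrow> real" where
  "schatten p A =
     (let q = char_poly (cadj A * A) in
      (\<Sum>z \<in> {z. poly q z = 0}. real (order z q) * (Re z) powr (p / 2)) powr (1 / p))"

definition max_p_norm :: "real \<Rightarrow> nat \<Rightarrow> (complex mat \<Rightarrow> complex mat) \<Rightarrow> real" where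
  "max_p_norm p n \<Omega> = (SUP \<rho> \<in> {\<rho>. density n \<rho>}. schatten p (\<Omega> \<rho>))"

end

theory Submission
  imports "HOL-Complex_Analysis.Complex_Analysis" "Jordan_Normal_Form.Schur_Decomposition" Defs
begin

text \<open>
  With \<open>G\<^sub>k = Tr\<^sub>1 ((X\<^sub>k \<otimes> 1) \<rho>)\<close> the output on a state \<open>\<rho>\<close> is \<open>\<Sum>\<^sub>k R\<^sub>k \<otimes> \<Omega>(G\<^sub>k)\<close>. Writing
  \<open>G\<^sub>k = x\<^sub>k \<tau>\<^sub>k\<close> with states \<open>\<tau>\<^sub>k\<close>, one has \<open>\<Phi>(Tr\<^sub>2 \<rho>) = \<Sum>\<^sub>k x\<^sub>k R\<^sub>k\<close>, so the upper bound reduces to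
  \<open>Tr M\<^sup>p \<le> V Tr S\<^sup>p\<close> for \<open>M = \<Sum>\<^sub>k R\<^sub>k \<otimes> W\<^sub>k\<close> and \<open>S = \<Sum>\<^sub>k R\<^sub>k\<close>, where \<open>R\<^sub>k, W\<^sub>k \<ge> 0\<close> and
  \<open>Tr W\<^sub>k\<^sup>p \<le> V\<close>. Instead of the Lieb-Thirring inequality we interpolate: with
  \<open>R\<^sub>k = S\<^sup>1\<^sup>/\<^sup>2 E\<^sub>k S\<^sup>1\<^sup>/\<^sup>2\<close>, the entire function
  \<open>f(z) = Tr ((S\<^sup>p\<^sup>z\<^sup>/\<^sup>2 \<otimes> 1) (\<Sum>\<^sub>k E\<^sub>k \<otimes> W\<^sub>k\<^sup>p\<^sup>z) (S\<^sup>p\<^sup>z\<^sup>/\<^sup>2 \<otimes> 1) M\<^sup>p\<^sup>(\<^sup>1\<^sup>-\<^sup>z\<^sup>))\<close>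
  satisfies \<open>f(1/p) = Tr M\<^sup>p\<close>, \<open>|f| \<le> Tr M\<^sup>p\<close> on \<open>Re z = 0\<close> and \<open>|f| \<le> V Tr S\<^sup>p\<close> on \<open>Re z = 1\<close>,
  and the three lines theorem yields the claim. In eigenbases of \<open>S\<close>, \<open>M\<close> and the \<open>W\<^sub>k\<close> all of this is
  about finite sums of exponentials. The lower bound comes from product states.
\<close>

section \<open>Interpolation\<close>

text \<open>Hadamard's three lines theorem. Multiplying \<open>f\<close> by
  \<open>A powr (z - 1) * B powr (- z)\<close> reduces the claim to the bound 1 on both boundary
  lines, and the maximum principle on large rectangles carries it inside. The a priori bound
  \<open>K\<close> controls only the horizontal edges and drops out in the limit.\<close>

lemma three_lines:
  fixes f :: "complex \<Rightarrow> complex" and A B \<theta> :: real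
  assumes hol: "f holomorphic_on UNIV"
    and bnd: "\<And>z. 0 \<le> Re z \<Longrightarrow> Re z \<le> 1 \<Longrightarrow> norm (f z) \<le> K"
    and A: "A > 0" "\<And>z. Re z = 0 \<Longrightarrow> norm (f z) \<le> A"
    and B: "B > 0" "\<And>z. Re z = 1 \<Longrightarrow> norm (f z) \<le> B"
    and \<theta>: "0 \<le> \<theta>" "\<theta> \<le> 1"
  shows "norm (f (of_real \<theta>)) \<le> A powr (1 - \<theta>) * B powr \<theta>"
proof -
  define D where "D = (1 - \<theta>) * ln A + \<theta> * ln B"
  have K0: "K \<ge> 0" using bnd[of 0] by (smt (verit) norm_ge_zero zero_complex.sel(1))
  have main: "norm (f (of_real \<theta>)) \<le> exp (D + \<epsilon> * (1 - \<theta>\<^sup>2))" if eps: "\<epsilon> > 0" for \<epsilon> :: real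
  proof -
    \<comment> \<open>The term \<open>\<epsilon> (z\<^sup>2 - 1)\<close> forces decay as \<open>|Im z| \<rightarrow> \<infinity>\<close>, which allows the maximum principle on a rectangle.\<close>
    define E where "E z = (z - 1) * of_real (ln A) - z * of_real (ln B) + of_real \<epsilon> * (z\<^sup>2 - 1)"
      for z :: complex
    define h where "h z = f z * exp (E z)" for z
    \<comment> \<open>\<open>T\<close> is so large that \<open>K * exp (\<bar>ln A\<bar> + \<bar>ln
      B\<bar>) \<le> \<epsilon> * T\<close>. As \<open>T \<ge> 1\<close>, this is at most
      \<open>\<epsilon> * T\<^sup>2\<close> and hence below
      \<open>exp (\<epsilon> * T\<^sup>2)\<close>, the damping on the horizontal edges.\<close>
    define T where "T = 1 + (K * exp (\<bar>ln A\<bar> + \<bar>ln B\<bar>)) / \<epsilon>"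
    have T: "T \<ge> 1" using K0 eps by (simp add: T_def)
    define S where "S = cbox (Complex 0 (-T)) (Complex 1 T)"
    have ReE: "Re (E z) = (Re z - 1) * ln A - Re z * ln B + \<epsilon> * ((Re z)\<^sup>2 - (Im z)\<^sup>2 - 1)" for z
      by (simp add: E_def power2_eq_square)
    have nh: "norm (h z) = norm (f z) * exp (Re (E z))" for z
      by (simp add: h_def norm_mult)
    have hh: "h holomorphic_on UNIV"
      unfolding h_def E_def by (intro holomorphic_intros hol)
    have "norm (h (of_real \<theta>)) \<le> 1"
    proof (rule maximum_modulus_frontier[of h S])
      show "h holomorphic_on interior S" by (rule holomorphic_on_subset[OF hh]) auto
      show "continuous_on (closure S) h"
        by (rule holomorphic_on_imp_continuous_on, rule holomorphic_on_subset[OF hh]) auto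
      show "bounded S" by (simp add: S_def)
      show "complex_of_real \<theta> \<in> S" using \<theta> T by (simp add: S_def in_cbox_complex_iff)
      fix z assume "z \<in> frontier S"
      hence zc: "0 \<le> Re z" "Re z \<le> 1" "-T \<le> Im z" "Im z \<le> T"
        and zo: "Re z = 0 \<or> Re z = 1 \<or> Im z = T \<or> Im z = - T"
        by (auto simp: S_def frontier_cbox in_cbox_complex_iff in_box_complex_iff)
      have sq: "(Re z)\<^sup>2 \<le> 1" using zc by (simp add: power_le_one)
      consider "Re z = 0" | "Re z = 1" | "\<bar>Im z\<bar> = T" using zo T by auto
      then show "norm (h z) \<le> 1"
      proof cases
        case 1
        have "- 1 \<le> (Im z)\<^sup>2" using zero_le_power2[of "Im z"] by linarith
        hence "Re (E z) \<le> - ln A" using 1 eps by (simp add: ReE mult_le_0_iff)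
        hence "norm (h z) \<le> A * exp (- ln A)" unfolding nh
          by (intro mult_mono A(2) 1) (use A in auto)
        thus ?thesis using A by (simp add: exp_minus)
      next
        case 2
        have "Re (E z) \<le> - ln B" using 2 eps by (simp add: ReE)
        hence "norm (h z) \<le> B * exp (- ln B)" unfolding nh
          by (intro mult_mono B(2) 2) (use B in auto)
        thus ?thesis using B by (simp add: exp_minus)
      next
        case 3
        let ?M = "\<bar>ln A\<bar> + \<bar>ln B\<bar>"
        have "(Im z)\<^sup>2 = T\<^sup>2" using 3 by (metis power2_abs)
        have "\<epsilon> * ((Re z)\<^sup>2 - (Im z)\<^sup>2 - 1) \<le> \<epsilon> * (- (T\<^sup>2))"
          using sq eps \<open>(Im z)\<^sup>2 = T\<^sup>2\<close> by (intro mult_left_mono) auto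
        moreover have "(Re z - 1) * ln A \<le> \<bar>ln A\<bar>"
        proof -
          have "(Re z - 1) * ln A \<le> \<bar>Re z - 1\<bar> * \<bar>ln A\<bar>" by (metis abs_ge_self abs_mult)
          also have "\<dots> \<le> 1 * \<bar>ln A\<bar>" using zc by (intro mult_right_mono) auto
          finally show ?thesis by simp
        qed
        moreover have "- (Re z * ln B) \<le> \<bar>ln B\<bar>"
        proof -
          have "- (Re z * ln B) \<le> \<bar>Re z\<bar> * \<bar>ln B\<bar>" by (metis abs_ge_minus_self abs_mult)
          also have "\<dots> \<le> 1 * \<bar>ln B\<bar>" using zc by (intro mult_right_mono) auto
          finally show ?thesis by simp
        qed
        ultimately have "Re (E z) \<le> ?M - \<epsilon> * T\<^sup>2" by (simp add: ReE)
        hence "norm (h z) \<le> K * exp (?M - \<epsilon> * T\<^sup>2)" unfolding nh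
          by (intro mult_mono bnd zc) (use K0 in auto)
        also have "\<dots> = K * exp ?M / exp (\<epsilon> * T\<^sup>2)" by (simp add: exp_diff)
        also have "\<dots> \<le> 1"
        proof -
          have "K * exp ?M \<le> \<epsilon> * T" using eps by (simp add: T_def field_simps)
          also have "\<dots> \<le> \<epsilon> * T\<^sup>2" using T eps by (simp add: power2_eq_square)
          also have "\<dots> \<le> exp (\<epsilon> * T\<^sup>2)" using exp_ge_add_one_self[of "\<epsilon> * T\<^sup>2"] by linarith
          finally show ?thesis by (simp add: divide_simps)
        qed
        finally show ?thesis .
      qed
    qed
    moreover have "Re (E (of_real \<theta>)) = - (D + \<epsilon> * (1 - \<theta>\<^sup>2))"
      by (simp add: ReE D_def algebra_simps)
    ultimately have "norm (f (of_real \<theta>)) * exp (- (D + \<epsilon> * (1 - \<theta>\<^sup>2))) \<le> 1"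
      by (metis nh)
    thus ?thesis by (subst (asm) exp_minus) (simp add: divide_simps)
  qed
  have "((\<lambda>\<epsilon>. exp (D + \<epsilon> * (1 - \<theta>\<^sup>2))) \<longlongrightarrow> exp (D + 0 * (1 - \<theta>\<^sup>2))) (at_right 0)"
    by (intro tendsto_intros)
  moreover have "\<forall>\<^sub>F \<epsilon> in at_right 0. norm (f (of_real \<theta>)) \<le> exp (D + \<epsilon> * (1 - \<theta>\<^sup>2))"
    unfolding eventually_at_right_field by (intro exI[of _ 1]) (auto intro: main)
  ultimately have "norm (f (of_real \<theta>)) \<le> exp (D + 0 * (1 - \<theta>\<^sup>2))"
    by (rule tendsto_lowerbound) simp
  thus ?thesis using A(1) B(1) by (simp add: D_def powr_def exp_add)
qed

text \<open>\<open>F\<close> is the orthogonal projection of \<open>f\<close> onto the span of the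
  \<open>g c\<close>, and the squared norm of \<open>f - F\<close> is the difference of the two
  sides.\<close>

lemma bessel:
  fixes g :: "'c \<Rightarrow> 'x \<Rightarrow> complex"
  assumes "finite X" "finite C"
    and g: "\<And>c d. c \<in> C \<Longrightarrow> d \<in> C \<Longrightarrow> (\<Sum>x\<in>X. cnj (g c x) * g d x) = (if c = d then 1 else 0)"
  shows "(\<Sum>c\<in>C. (cmod (\<Sum>x\<in>X. cnj (g c x) * f x))\<^sup>2) \<le> (\<Sum>x\<in>X. (cmod (f x))\<^sup>2)"
proof -
  define k where "k c = (\<Sum>x\<in>X. cnj (g c x) * f x)" for c
  define F where "F x = (\<Sum>c\<in>C. k c * g c x)" for x
  have fF: "(\<Sum>x\<in>X. cnj (F x) * f x) = (\<Sum>c\<in>C. cnj (k c) * k c)"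
  proof -
    have "(\<Sum>x\<in>X. cnj (F x) * f x) = (\<Sum>x\<in>X. \<Sum>c\<in>C. cnj (k c) * (cnj (g c x) * f x))"
      by (simp add: F_def sum_distrib_right sum_distrib_left mult_ac)
    also have "\<dots> = (\<Sum>c\<in>C. cnj (k c) * k c)"
      by (subst sum.swap) (simp add: sum_distrib_left k_def)
    finally show ?thesis .
  qed
  have FF: "(\<Sum>x\<in>X. cnj (F x) * F x) = (\<Sum>c\<in>C. cnj (k c) * k c)"
  proof -
    have "(\<Sum>x\<in>X. cnj (F x) * F x) = (\<Sum>x\<in>X. \<Sum>c\<in>C. \<Sum>d\<in>C. cnj (k c) * k d * (cnj (g c x) * g d x))"
      by (simp only: F_def cnj_sum sum_product) (simp add: mult_ac)
    also have "\<dots> = (\<Sum>c\<in>C. \<Sum>d\<in>C. cnj (k c) * k d * (\<Sum>x\<in>X. cnj (g c x) * g d x))"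
      by (subst sum.swap, intro sum.cong refl, subst sum.swap) (simp add: sum_distrib_left)
    also have "\<dots> = (\<Sum>c\<in>C. \<Sum>d\<in>C. if c = d then cnj (k c) * k d else 0)"
      by (intro sum.cong refl) (simp add: g)
    also have "\<dots> = (\<Sum>c\<in>C. cnj (k c) * k c)" using assms(2) by simp
    finally show ?thesis .
  qed
  have "cnj (\<Sum>x\<in>X. cnj (F x) * f x) = cnj (\<Sum>c\<in>C. cnj (k c) * k c)" using fF by simp
  hence Ff: "(\<Sum>x\<in>X. cnj (f x) * F x) = (\<Sum>c\<in>C. cnj (k c) * k c)" by (simp add: mult.commute)
  have "complex_of_real (\<Sum>x\<in>X. (cmod (f x - F x))\<^sup>2) = (\<Sum>x\<in>X. cnj (f x - F x) * (f x - F x))"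
    by (simp add: mult.commute complex_norm_square del: complex_cnj_diff of_real_power)
  also have "\<dots> = (\<Sum>x\<in>X. cnj (f x) * f x) - (\<Sum>c\<in>C. cnj (k c) * k c)"
    using fF FF Ff by (simp add: algebra_simps sum.distrib sum_subtractf)
  also have "\<dots> = of_real ((\<Sum>x\<in>X. (cmod (f x))\<^sup>2) - (\<Sum>c\<in>C. (cmod (k c))\<^sup>2))"
    by (simp add: mult.commute complex_norm_square del: of_real_power)
  finally have "(\<Sum>x\<in>X. (cmod (f x))\<^sup>2) - (\<Sum>c\<in>C. (cmod (k c))\<^sup>2) = (\<Sum>x\<in>X. (cmod (f x - F x))\<^sup>2)"
    using of_real_eq_iff by metis
  moreover have "\<dots> \<ge> 0" by (intro sum_nonneg) auto
  ultimately show ?thesis by (simp add: k_def)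
qed

text \<open>Cauchy-Schwarz when both factors obey the same bound:
  \<open>2 a b \<le> a^2 + b^2\<close> termwise suffices, without square roots.\<close>

lemma sum_cauchy_amgm:
  fixes a b :: "'i \<Rightarrow> complex"
  assumes "(\<Sum>i\<in>I. m i * (cmod (a i))\<^sup>2) \<le> M" "(\<Sum>i\<in>I. m i * (cmod (b i))\<^sup>2) \<le> M"
    and "\<And>i. i \<in> I \<Longrightarrow> 0 \<le> m i"
  shows "(\<Sum>i\<in>I. m i * (cmod (a i) * cmod (b i))) \<le> (M :: real)"
proof -
  have "(\<Sum>i\<in>I. m i * (cmod (a i) * cmod (b i)))
      \<le> (\<Sum>i\<in>I. (m i * (cmod (a i))\<^sup>2 + m i * (cmod (b i))\<^sup>2) / 2)"
  proof (rule sum_mono)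
    fix i assume i: "i \<in> I"
    have "2 * (cmod (a i) * cmod (b i)) \<le> (cmod (a i))\<^sup>2 + (cmod (b i))\<^sup>2"
      using sum_squares_bound[of "cmod (a i)" "cmod (b i)"] by (simp add: mult_ac)
    from mult_left_mono[OF this assms(3)[OF i]]
    show "m i * (cmod (a i) * cmod (b i)) \<le> (m i * (cmod (a i))\<^sup>2 + m i * (cmod (b i))\<^sup>2) / 2"
      by (simp add: algebra_simps)
  qed
  also have "\<dots> \<le> M" using assms(1,2)
    by (simp add: sum_divide_distrib[symmetric] sum.distrib)
  finally show ?thesis .
qed

text \<open>
  \<open>A\<close> indexes an eigenbasis of \<open>S = \<Sum>\<^sub>k \<psi>\<^sub>k \<psi>\<^sub>k\<^sup>*\<close>, in which the \<open>\<psi>\<^sub>k\<close> are expressed, and \<open>W\<^sub>k\<close> has eigenvalues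
  \<open>w k j\<close> and eigenvectors \<open>e k j\<close>. Below, \<open>\<phi>\<^sub>k = S\<^sup>-\<^sup>1\<^sup>/\<^sup>2 \<psi>\<^sub>k\<close> (zero on the kernel of \<open>S\<close>), \<open>overlap t\<close> collects
  the inner products of \<open>g\<^sub>c\<close> with \<open>diag(t) \<phi>\<^sub>k \<otimes> e\<^sub>k\<^sub>j\<close>, and \<open>\<mu>\<^sub>c\<close> is the expectation of
  \<open>\<Sum>\<^sub>k \<psi>\<^sub>k \<psi>\<^sub>k\<^sup>* \<otimes> W\<^sub>k\<close> in \<open>g\<^sub>c\<close>.
\<close>

locale product_overlap =
  fixes A :: "'a set" and K :: "'k set" and J :: "'j set" and Y :: "'y set" and C :: "'c set"
    and s :: "'a \<Rightarrow> real" and \<psi> :: "'k \<Rightarrow> 'a \<Rightarrow> complex" and w :: "'k \<Rightarrow> 'j \<Rightarrow> real"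
    and e :: "'k \<Rightarrow> 'j \<Rightarrow> 'y \<Rightarrow> complex" and g :: "'c \<Rightarrow> 'a \<times> 'y \<Rightarrow> complex"
  assumes fin: "finite A" "finite K" "finite J" "finite Y" "finite C"
    and s0: "\<And>a. a \<in> A \<Longrightarrow> 0 \<le> s a"
    and frame: "\<And>a b. a \<in> A \<Longrightarrow> b \<in> A \<Longrightarrow>
      (\<Sum>k\<in>K. \<psi> k a * cnj (\<psi> k b)) = (if a = b then of_real (s a) else 0)"
    and e: "\<And>k i j. k \<in> K \<Longrightarrow> i \<in> J \<Longrightarrow> j \<in> J \<Longrightarrow>
      (\<Sum>y\<in>Y. cnj (e k i y) * e k j y) = (if i = j then 1 else 0)"
    and w0: "\<And>k j. k \<in> K \<Longrightarrow> j \<in> J \<Longrightarrow> 0 \<le> w k j"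
    and g: "\<And>c d. c \<in> C \<Longrightarrow> d \<in> C \<Longrightarrow>
      (\<Sum>x\<in>A\<times>Y. cnj (g c x) * g d x) = (if c = d then 1 else 0)"
begin

definition \<phi> :: "'k \<Rightarrow> 'a \<Rightarrow> complex" where
  "\<phi> k a = (if s a = 0 then 0 else \<psi> k a / of_real (sqrt (s a)))"

definition overlap :: "('a \<Rightarrow> complex) \<Rightarrow> 'c \<times> 'k \<times> 'j \<Rightarrow> complex" where
  "overlap t = (\<lambda>(c, k, j). \<Sum>(a, y)\<in>A\<times>Y. cnj (g c (a, y)) * (t a * \<phi> k a * e k j y))"

definition \<mu> :: "'c \<Rightarrow> real" where
  "\<mu> c = (\<Sum>k\<in>K. \<Sum>j\<in>J. w k j * (cmod (\<Sum>(a, y)\<in>A\<times>Y. cnj (g c (a, y)) * (\<psi> k a * e k j y)))\<^sup>2)"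

lemma \<mu>0: "0 \<le> \<mu> c"
  unfolding \<mu>_def by (intro sum_nonneg mult_nonneg_nonneg w0) auto

text \<open>The diagonal of \<open>frame\<close> says that the squared moduli of the
  \<open>\<psi> k a\<close> sum to \<open>s a\<close>. Hence putting \<open>\<phi>\<close> to zero
  on the kernel of \<open>S\<close> loses nothing.\<close>

lemma \<psi>_zero: "\<psi> k a = 0" if "a \<in> A" "s a = 0" "k \<in> K"
proof -
  have "complex_of_real (\<Sum>k\<in>K. (cmod (\<psi> k a))\<^sup>2) = 0"
    using frame[of a a] that by (simp add: complex_norm_square del: of_real_power)
  hence "(\<Sum>k\<in>K. (cmod (\<psi> k a))\<^sup>2) = 0" using of_real_eq_0_iff by blast
  thus ?thesis using that fin by (subst (asm) sum_nonneg_eq_0_iff) auto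
qed

text \<open>In operator terms, the rank-one operators built from the \<open>\<phi> k\<close> sum to
  the projection onto the support of \<open>S\<close>.\<close>

lemma \<phi>_frame:
  assumes "a \<in> A" "b \<in> A"
  shows "(\<Sum>k\<in>K. \<phi> k a * cnj (\<phi> k b)) = (if a = b \<and> s a \<noteq> 0 then 1 else 0)"
proof (cases "s a = 0 \<or> s b = 0")
  case True
  then show ?thesis by (auto simp: \<phi>_def)
next
  case False
  hence "(\<Sum>k\<in>K. \<phi> k a * cnj (\<phi> k b))
      = (\<Sum>k\<in>K. \<psi> k a * cnj (\<psi> k b)) / (of_real (sqrt (s a)) * of_real (sqrt (s b)))"
    by (simp add: \<phi>_def sum_divide_distrib)
  also have "\<dots> = (if a = b \<and> s a \<noteq> 0 then 1 else 0)"
    using False assms s0[of a] by (auto simp: frame simp flip: of_real_mult)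
  finally show ?thesis .
qed

lemma \<phi>_norm: "a \<in> A \<Longrightarrow> (\<Sum>k\<in>K. (cmod (\<phi> k a))\<^sup>2) \<le> 1"
proof -
  assume a: "a \<in> A"
  have "complex_of_real (\<Sum>k\<in>K. (cmod (\<phi> k a))\<^sup>2) = of_real (if s a \<noteq> 0 then 1 else 0)"
    using \<phi>_frame[OF a a] by (simp add: complex_norm_square del: of_real_power)
  hence "(\<Sum>k\<in>K. (cmod (\<phi> k a))\<^sup>2) = (if s a \<noteq> 0 then 1 else 0)" using of_real_eq_iff by blast
  thus ?thesis by simp
qed

text \<open>For fixed \<open>k\<close>, Bessel's inequality for the \<open>e k j\<close> absorbs the
  sum over \<open>j\<close>. Then \<open>\<phi>_frame\<close> collapses the sum over
  \<open>k\<close> to the support of \<open>s\<close>, where \<open>t\<close> contracts, and the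
  squared norm of \<open>g c\<close> remains as a bound.\<close>

lemma overlap_left:
  assumes t: "\<And>a. a \<in> A \<Longrightarrow> cmod (t a) \<le> 1" and c: "c \<in> C"
  shows "(\<Sum>k\<in>K. \<Sum>j\<in>J. (cmod (overlap t (c, k, j)))\<^sup>2) \<le> 1"
proof -
  \<comment> \<open>The partial inner product of \<open>g c\<close> with
    \<open>t a * \<phi> k a\<close> over \<open>A\<close>; its coefficient along
    \<open>e k j\<close> is the conjugate of \<open>overlap\<close>.\<close>
  define F where "F k y = (\<Sum>a\<in>A. g c (a, y) * cnj (t a * \<phi> k a))" for k y
  have ov: "cmod (overlap t (c, k, j)) = cmod (\<Sum>y\<in>Y. cnj (e k j y) * F k y)" for k j
  proof -
    have "cnj (overlap t (c, k, j)) = (\<Sum>y\<in>Y. cnj (e k j y) * F k y)"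
      unfolding overlap_def F_def sum.cartesian_product[symmetric] prod.case
      by (subst sum.swap) (simp add: sum_distrib_left mult_ac)
    thus ?thesis by (metis complex_mod_cnj)
  qed
  have "(\<Sum>k\<in>K. \<Sum>j\<in>J. (cmod (overlap t (c, k, j)))\<^sup>2) \<le> (\<Sum>k\<in>K. \<Sum>y\<in>Y. (cmod (F k y))\<^sup>2)"
    unfolding ov by (intro sum_mono bessel fin e)
  also have "\<dots> \<le> (\<Sum>y\<in>Y. \<Sum>a\<in>A. (cmod (g c (a, y)))\<^sup>2)"
  proof (subst sum.swap, intro sum_mono)
    fix y assume y: "y \<in> Y"
    have "complex_of_real (\<Sum>k\<in>K. (cmod (F k y))\<^sup>2) = (\<Sum>k\<in>K. cnj (F k y) * F k y)"
      by (simp add: complex_norm_square mult.commute del: of_real_power)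
    also have "\<dots> = (\<Sum>k\<in>K. \<Sum>a\<in>A. \<Sum>b\<in>A. (cnj (g c (a, y)) * t a * g c (b, y) * cnj (t b)) * (\<phi> k a * cnj (\<phi> k b)))"
      by (simp only: F_def cnj_sum sum_product) (simp add: mult_ac)
    also have "\<dots> = (\<Sum>a\<in>A. \<Sum>b\<in>A. (cnj (g c (a, y)) * t a * g c (b, y) * cnj (t b)) * (\<Sum>k\<in>K. \<phi> k a * cnj (\<phi> k b)))"
      by (subst sum.swap, intro sum.cong refl, subst sum.swap) (simp add: sum_distrib_left)
    also have "\<dots> = (\<Sum>a\<in>A. \<Sum>b\<in>A. if a = b then (if s a \<noteq> 0 then (cnj (g c (a, y)) * t a * g c (b, y) * cnj (t b)) else 0) else 0)"
      by (intro sum.cong refl) (auto simp: \<phi>_frame)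
    also have "\<dots> = (\<Sum>a\<in>A. (if s a \<noteq> 0 then (cnj (g c (a, y)) * t a * g c (a, y) * cnj (t a)) else 0))"
      using fin by simp
    also have "\<dots> = complex_of_real (\<Sum>a\<in>A. if s a \<noteq> 0 then (cmod (g c (a, y)))\<^sup>2 * (cmod (t a))\<^sup>2 else 0)"
      unfolding of_real_sum by (intro sum.cong refl) (simp add: complex_norm_square mult_ac del: of_real_power)
    finally have "(\<Sum>k\<in>K. (cmod (F k y))\<^sup>2) = (\<Sum>a\<in>A. if s a \<noteq> 0 then (cmod (g c (a, y)))\<^sup>2 * (cmod (t a))\<^sup>2 else 0)"
      using of_real_eq_iff by blast
    also have "\<dots> \<le> (\<Sum>a\<in>A. (cmod (g c (a, y)))\<^sup>2)"
      by (intro sum_mono) (auto simp: t power_le_one intro!: mult_left_le)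
    finally show "(\<Sum>k\<in>K. (cmod (F k y))\<^sup>2) \<le> (\<Sum>a\<in>A. (cmod (g c (a, y)))\<^sup>2)" .
  qed
  also have "\<dots> = 1"
  proof -
    have "complex_of_real (\<Sum>y\<in>Y. \<Sum>a\<in>A. (cmod (g c (a, y)))\<^sup>2) = 1"
      using g[OF c c] by (subst sum.swap) (simp add: sum.cartesian_product' complex_norm_square mult.commute del: of_real_power)
    thus ?thesis using of_real_eq_1_iff by blast
  qed
  finally show ?thesis .
qed

text \<open>The overlaps are the coefficients of one product vector along the orthonormal
  \<open>g c\<close>. Its second factor \<open>e k j\<close> is a unit vector, so Bessel leaves the
  norm of the first factor.\<close>

lemma overlap_right:
  assumes k: "k \<in> K" and j: "j \<in> J"
  shows "(\<Sum>c\<in>C. (cmod (overlap t (c, k, j)))\<^sup>2) \<le> (\<Sum>a\<in>A. (cmod (t a))\<^sup>2 * (cmod (\<phi> k a))\<^sup>2)"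
proof -
  define f where "f = (\<lambda>(a, y). t a * \<phi> k a * e k j y)"
  have "overlap t (c, k, j) = (\<Sum>x\<in>A\<times>Y. cnj (g c x) * f x)" for c
    unfolding overlap_def f_def by (simp add: case_prod_unfold)
  hence "(\<Sum>c\<in>C. (cmod (overlap t (c, k, j)))\<^sup>2) \<le> (\<Sum>x\<in>A\<times>Y. (cmod (f x))\<^sup>2)"
    using fin by (simp only:) (intro bessel g, auto)
  also have "\<dots> = (\<Sum>a\<in>A. (cmod (t a))\<^sup>2 * (cmod (\<phi> k a))\<^sup>2 * (\<Sum>y\<in>Y. (cmod (e k j y))\<^sup>2))"
    by (simp add: f_def sum.cartesian_product' norm_mult power_mult_distrib sum_distrib_left)
  also have "(\<Sum>y\<in>Y. (cmod (e k j y))\<^sup>2) = 1"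
  proof -
    have "complex_of_real (\<Sum>y\<in>Y. (cmod (e k j y))\<^sup>2) = 1"
      using e[OF k j j] by (simp add: complex_norm_square mult.commute del: of_real_power)
    thus ?thesis using of_real_eq_1_iff by blast
  qed
  finally show ?thesis by simp
qed

text \<open>The estimate for the line \<open>Re z = 0\<close>, where the weight depends on
  \<open>c\<close> alone and the sum over \<open>k\<close> and \<open>j\<close> is done
  first.\<close>

lemma overlap_bound_0:
  assumes t: "\<And>a. a \<in> A \<Longrightarrow> cmod (t a) \<le> 1" and m: "\<And>c. c \<in> C \<Longrightarrow> 0 \<le> m c"
  shows "(\<Sum>(c, k, j)\<in>C\<times>K\<times>J. m c * (cmod (overlap t (c, k, j)))\<^sup>2) \<le> (\<Sum>c\<in>C. m c)"
proof -
  have "(\<Sum>(c, k, j)\<in>C\<times>K\<times>J. m c * (cmod (overlap t (c, k, j)))\<^sup>2)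
      = (\<Sum>c\<in>C. m c * (\<Sum>k\<in>K. \<Sum>j\<in>J. (cmod (overlap t (c, k, j)))\<^sup>2))"
    by (simp add: sum.cartesian_product' sum_distrib_left)
  also have "\<dots> \<le> (\<Sum>c\<in>C. m c)"
    by (intro sum_mono mult_left_le overlap_left t m)
  finally show ?thesis .
qed

text \<open>The estimate for the line \<open>Re z = 1\<close>, where the weight depends on
  \<open>k\<close> and \<open>j\<close> and the sum over \<open>c\<close> is done first. Then
  \<open>V\<close> bounds the sum over \<open>j\<close> uniformly in \<open>k\<close>, and
  \<open>\<phi>_norm\<close> handles the sum over \<open>k\<close>.\<close>

lemma overlap_bound_1:
  assumes t: "\<And>a. a \<in> A \<Longrightarrow> (cmod (t a))\<^sup>2 = s a powr p"
    and V: "\<And>k. k \<in> K \<Longrightarrow> (\<Sum>j\<in>J. w k j powr p) \<le> V" and V0: "0 \<le> V"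
  shows "(\<Sum>(c, k, j)\<in>C\<times>K\<times>J. w k j powr p * (cmod (overlap t (c, k, j)))\<^sup>2)
    \<le> V * (\<Sum>a\<in>A. s a powr p)"
proof -
  let ?N = "\<lambda>k. \<Sum>a\<in>A. s a powr p * (cmod (\<phi> k a))\<^sup>2"
  have "(\<Sum>(c, k, j)\<in>C\<times>K\<times>J. w k j powr p * (cmod (overlap t (c, k, j)))\<^sup>2)
      = (\<Sum>k\<in>K. \<Sum>j\<in>J. w k j powr p * (\<Sum>c\<in>C. (cmod (overlap t (c, k, j)))\<^sup>2))"
    by (simp add: sum.cartesian_product' sum_distrib_left)
       (subst sum.swap, intro sum.cong refl, rule sum.swap)
  also have "\<dots> \<le> (\<Sum>k\<in>K. \<Sum>j\<in>J. w k j powr p * ?N k)"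
    using overlap_right[of _ _ t] by (intro sum_mono mult_left_mono) (auto simp: t)
  also have "\<dots> = (\<Sum>k\<in>K. (\<Sum>j\<in>J. w k j powr p) * ?N k)" by (simp add: sum_distrib_right)
  also have "\<dots> \<le> (\<Sum>k\<in>K. V * ?N k)"
    by (intro sum_mono mult_right_mono V sum_nonneg) auto
  also have "\<dots> = (\<Sum>a\<in>A. (V * s a powr p) * (\<Sum>k\<in>K. (cmod (\<phi> k a))\<^sup>2))"
    by (simp add: sum_distrib_left mult.assoc) (rule sum.swap)
  also have "\<dots> \<le> (\<Sum>a\<in>A. V * s a powr p)"
    by (intro sum_mono mult_left_le \<phi>_norm mult_nonneg_nonneg V0) auto
  finally show ?thesis by (simp add: sum_distrib_left)
qed

end

lemma norm_real_powr: "0 \<le> x \<Longrightarrow> cmod (of_real x powr z) = x powr Re z"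
  by (subst norm_powr_real_powr) auto

text \<open>With a base of at least 1 the power grows with the exponent even when
  \<open>x < 1\<close>. This gives bounds independent of \<open>z\<close> on the whole
  strip.\<close>

lemma powr_le_powr_Suc: "0 \<le> x \<Longrightarrow> 0 \<le> a \<Longrightarrow> a \<le> b \<Longrightarrow> x powr a \<le> (1 + x) powr (b :: real)"
  by (rule order_trans[OF powr_mono2[of a x "1 + x"] powr_mono]) auto

context product_overlap
begin

text \<open>When the \<open>\<mu> c\<close> are the eigenvalues of \<open>M\<close>, this is
  \<open>Tr M^p \<le> V Tr S^p\<close>. Up to strict positivity of the bounds, three lines at
  \<open>1 / p\<close> gives \<open>L \<le> L powr (1 - 1 / p) * R powr (1 / p)\<close>, and the
  power of \<open>L\<close> cancels.\<close>

theorem sum_powr_overlap_le: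
  assumes p: "1 \<le> p" and V: "\<And>k. k \<in> K \<Longrightarrow> (\<Sum>j\<in>J. w k j powr p) \<le> V" and V0: "0 \<le> V"
  shows "(\<Sum>c\<in>C. \<mu> c powr p) \<le> V * (\<Sum>a\<in>A. s a powr p)"
proof -
  define L where "L = (\<Sum>c\<in>C. \<mu> c powr p)"
  define R where "R = V * (\<Sum>a\<in>A. s a powr p)"
  have L0: "0 \<le> L" unfolding L_def by (intro sum_nonneg) auto
  \<comment> \<open>\<open>B\<close> stands in for \<open>R\<close>, which may be 0 while
    \<open>three_lines\<close> needs strictly positive bounds; it is lowered to
    \<open>max R 0\<close> at the end.\<close>
  have "L \<le> B" if B: "B > 0" "R \<le> B" and L: "L > 0" for B
  proof -
    \<comment> \<open>\<open>t z\<close> carries the eigenvalues of \<open>S^(p z / 2)\<close>, and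
      \<open>m z\<close> those of \<open>M^(p (1 - z))\<close> and \<open>W_k^(p z)\<close>. As
      \<open>0 powr z = 0\<close> for every \<open>z\<close>, zero eigenvalues do not disturb
      holomorphy.\<close>
    define t where "t z a = complex_of_real (s a) powr (of_real (p / 2) * z)" for z a
    define m where "m z = (\<lambda>(c, k, j). complex_of_real (\<mu> c) powr (of_real p * (1 - z))
        * complex_of_real (w k j) powr (of_real p * z))" for z
    define f where "f z = (\<Sum>i\<in>C\<times>K\<times>J. m z i * (overlap (t z) i * cnj (overlap (\<lambda>a. cnj (t z a)) i)))" for z
    \<comment> \<open>The second factor is conjugated twice, so that \<open>f\<close> depends holomorphically on \<open>z\<close>.\<close>
    have nt: "cmod (t z a) = s a powr (p / 2 * Re z)" if "a \<in> A" for z a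
      using s0[OF that] by (simp add: t_def norm_real_powr)
    have nm: "cmod (m z (c, k, j)) = \<mu> c powr (p * (1 - Re z)) * w k j powr (p * Re z)"
      if "k \<in> K" "j \<in> J" for z c k j
      using \<mu>0 w0[OF that] by (simp add: m_def norm_mult norm_real_powr)
    have nf: "cmod (f z) \<le> (\<Sum>i\<in>C\<times>K\<times>J. cmod (m z i)
        * (cmod (overlap (t z) i) * cmod (overlap (\<lambda>a. cnj (t z a)) i)))" for z
      unfolding f_def by (rule order_trans[OF norm_sum]) (simp add: norm_mult)
    have "cmod (f (of_real (1 / p))) \<le> L powr (1 - 1 / p) * B powr (1 / p)"
    proof (rule three_lines)
      have "(\<lambda>z. overlap (t z) i) holomorphic_on UNIV" for i
        unfolding overlap_def t_def case_prod_unfold by (intro holomorphic_intros)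
      moreover have "cnj (overlap (\<lambda>a. cnj (t z a)) i)
          = (case i of (c, k, j) \<Rightarrow> \<Sum>(a, y)\<in>A\<times>Y. g c (a, y) * (t z a * cnj (\<phi> k a * e k j y)))" for z i
        by (simp add: overlap_def case_prod_unfold mult.assoc)
      then have "(\<lambda>z. cnj (overlap (\<lambda>a. cnj (t z a)) i)) holomorphic_on UNIV" for i
        by (simp only:) (unfold case_prod_unfold t_def, intro holomorphic_intros)
      ultimately show "f holomorphic_on UNIV"
        unfolding f_def m_def case_prod_unfold by (intro holomorphic_intros)
    next
      \<comment> \<open>Any bound independent of \<open>z\<close> will do on the strip: each
        exponent is raised to \<open>p\<close> and each base by 1.\<close>
      define N where "N i = (case i of (c, k, j) \<Rightarrow>
          \<Sum>(a, y)\<in>A\<times>Y. cmod (g c (a, y)) * ((1 + s a) powr p * cmod (\<phi> k a) * cmod (e k j y)))" for i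
      define M where "M i = (case i of (c, k, j) \<Rightarrow> (1 + \<mu> c) powr p * (1 + w k j) powr p)" for i
      fix z :: complex assume z: "0 \<le> Re z" "Re z \<le> 1"
      have ov: "cmod (overlap u i) \<le> N i" if u: "\<And>a. a \<in> A \<Longrightarrow> cmod (u a) = cmod (t z a)" for u i
      proof -
        have "cmod (u a) \<le> (1 + s a) powr p" if "a \<in> A" for a
          unfolding u[OF that] nt[OF that] using z p s0[OF that]
            mult_mono[of "p / 2" p "Re z" 1] by (intro powr_le_powr_Suc) auto
        then show ?thesis
          by (cases i) (auto simp: overlap_def N_def norm_mult
              intro!: order_trans[OF norm_sum] sum_mono mult_left_mono mult_right_mono)
      qed
      have "cmod (m z i) \<le> M i" if "i \<in> C\<times>K\<times>J" for i
        using that z p \<mu>0 mult_left_le[of "Re z" p] mult_left_le[of "1 - Re z" p]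
        by (auto simp: nm M_def intro!: mult_mono powr_le_powr_Suc w0)
      then show "cmod (f z) \<le> (\<Sum>i\<in>C\<times>K\<times>J. M i * (N i * N i))"
        by (intro order_trans[OF nf] sum_mono mult_mono ov)
           (auto intro: order_trans[OF norm_ge_zero] order_trans[OF norm_ge_zero ov[OF refl]])
    next
      fix z :: complex assume z: "Re z = 0"
      \<comment> \<open>The exponents of \<open>s\<close> and \<open>w\<close> have real part 0, and
        \<open>x powr 0\<close> is 1 for \<open>x > 0\<close> but 0 for \<open>x = 0\<close>. So
        these factors are at most 1, with equality off the kernels.\<close>
      have t1: "cmod (t z a) \<le> 1" if "a \<in> A" for a using that z by (simp add: nt)
      have "cmod (f z) \<le> (\<Sum>i\<in>C\<times>K\<times>J. \<mu> (fst i) powr p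
        * (cmod (overlap (t z) i) * cmod (overlap (\<lambda>a. cnj (t z a)) i)))"
        using z by (intro order_trans[OF nf] sum_mono mult_right_mono) (auto simp: nm)
      also have "\<dots> \<le> L"
        using overlap_bound_0[of "t z" "\<lambda>c. \<mu> c powr p"]
          overlap_bound_0[of "\<lambda>a. cnj (t z a)" "\<lambda>c. \<mu> c powr p"] t1
        by (intro sum_cauchy_amgm) (auto simp: L_def case_prod_unfold)
      finally show "cmod (f z) \<le> L" .
    next
      fix z :: complex assume z: "Re z = 1"
      have t1: "(cmod (t z a))\<^sup>2 = s a powr p" if "a \<in> A" for a using that z
        by (simp add: nt power2_eq_square flip: powr_add)
      have "cmod (f z) \<le> (\<Sum>i\<in>C\<times>K\<times>J. w (fst (snd i)) (snd (snd i)) powr p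
        * (cmod (overlap (t z) i) * cmod (overlap (\<lambda>a. cnj (t z a)) i)))"
        using z by (intro order_trans[OF nf] sum_mono mult_right_mono) (auto simp: nm)
      also have "\<dots> \<le> R"
        using overlap_bound_1[of "t z" p V] overlap_bound_1[of "\<lambda>a. cnj (t z a)" p V] t1 V V0
        by (intro sum_cauchy_amgm) (auto simp: R_def case_prod_unfold)
      finally show "cmod (f z) \<le> B" using B by simp
    qed (use L B p in auto)
    \<comment> \<open>At \<open>z = 1 / p\<close> the factor \<open>t\<close> is
      \<open>sqrt (s a)\<close>, which undoes the normalisation in \<open>\<phi>\<close>, and
      \<open>w\<close> has exponent 1. The sum over \<open>k\<close> and \<open>j\<close> then
      reproduces \<open>\<mu> c\<close>, next to the factor
      \<open>\<mu> c powr (p - 1)\<close>.\<close>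
    moreover have "f (of_real (1 / p)) = of_real L"
    proof -
      define q where "q = complex_of_real (1 / p)"
      have t: "t q a * \<phi> k a = \<psi> k a" "cnj (t q a) * \<phi> k a = \<psi> k a"
        if "a \<in> A" "k \<in> K" for a k
      proof -
        have "t q a = complex_of_real (s a) powr of_real (1 / 2)"
          using p by (simp add: t_def q_def flip: of_real_mult)
        also have "\<dots> = of_real (sqrt (s a))"
          using s0[OF that(1)] by (subst powr_of_real) (auto simp: powr_half_sqrt)
        finally show "t q a * \<phi> k a = \<psi> k a" "cnj (t q a) * \<phi> k a = \<psi> k a"
          using that \<psi>_zero s0[OF that(1)] by (auto simp: \<phi>_def)
      qed
      define G where "G i = (case i of (c, k, j) \<Rightarrow> \<Sum>(a, y)\<in>A\<times>Y. cnj (g c (a, y)) * (\<psi> k a * e k j y))" for i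
      have ov: "overlap (t q) i = G i"
        "overlap (\<lambda>a. cnj (t q a)) i = G i" if "i \<in> C\<times>K\<times>J" for i
        using that by (auto simp: overlap_def G_def t intro!: sum.cong)
      have m: "m q (c, k, j) = of_real (\<mu> c powr (p - 1) * w k j)"
        if "k \<in> K" "j \<in> J" for c k j
      proof -
        have "complex_of_real p * (1 - q) = of_real (p - 1)"
          "complex_of_real p * q = of_real 1"
          using p by (simp_all add: q_def field_simps)
        then show ?thesis using \<mu>0[of c] w0[OF that]
          by (simp only: m_def prod.case) (subst powr_of_real, simp_all)+
      qed
      have "f q = (\<Sum>(c, k, j)\<in>C\<times>K\<times>J. of_real (\<mu> c powr (p - 1) * (w k j * (cmod (G (c, k, j)))\<^sup>2)))"
        unfolding f_def by (intro sum.cong refl)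
          (auto simp: ov m complex_norm_square mult.assoc simp del: of_real_power)
      also have "\<dots> = of_real (\<Sum>c\<in>C. \<mu> c powr (p - 1) * \<mu> c)"
        by (simp add: sum.cartesian_product' sum_distrib_left \<mu>_def[of "_ :: 'c"] G_def)
      also have "(\<Sum>c\<in>C. \<mu> c powr (p - 1) * \<mu> c) = L"
        unfolding L_def using \<mu>0 p by (intro sum.cong refl) (simp add: powr_mult_base' powr_diff)
      finally show ?thesis by (simp add: q_def)
    qed
    ultimately have "L \<le> L powr (1 - 1 / p) * B powr (1 / p)" using L by simp
    moreover have "L powr (1 - 1 / p) * L powr (1 / p) = L" using L p by (simp flip: powr_add)
    ultimately have "L powr (1 - 1 / p) * L powr (1 / p) \<le> L powr (1 - 1 / p) * B powr (1 / p)"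
      by simp
    hence "L powr (1 / p) \<le> B powr (1 / p)" using L by simp
    then show ?thesis using L B p powr_less_mono2[of "1 / p" B L] by fastforce
  qed
  then have "L \<le> max R 0 + \<epsilon>" if "\<epsilon> > 0" for \<epsilon>
    using that by (cases "L > 0") (auto simp: max_def intro: order_trans)
  then have "L \<le> max R 0" by (rule field_le_epsilon)
  moreover have "0 \<le> R" unfolding R_def by (intro mult_nonneg_nonneg V0 sum_nonneg) auto
  ultimately show ?thesis by (simp add: L_def R_def)
qed

end

section \<open>Spectral decompositions\<close>

text \<open>Vectors are functions of which only the first \<open>n\<close> values count, so that
  slices and products of vectors on a product index need no carrier conditions.\<close>

definition cip :: "nat \<Rightarrow> (nat \<Rightarrow> complex) \<Rightarrow> (nat \<Rightarrow> complex) \<Rightarrow> complex" where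
  "cip n f g = (\<Sum>i<n. cnj (f i) * g i)"

definition apply_ker :: "nat \<Rightarrow> (nat \<Rightarrow> nat \<Rightarrow> complex) \<Rightarrow> (nat \<Rightarrow> complex) \<Rightarrow> nat \<Rightarrow> complex" where
  "apply_ker n a f i = (\<Sum>j<n. a i j * f j)"

definition orthonormal :: "nat \<Rightarrow> (nat \<Rightarrow> nat \<Rightarrow> complex) \<Rightarrow> bool" where
  "orthonormal n u \<longleftrightarrow> (\<forall>c<n. \<forall>d<n. cip n (u c) (u d) = (if c = d then 1 else 0))"

lemma cip_sum_right: "cip n f (\<lambda>x. \<Sum>i\<in>I. k i * h i x) = (\<Sum>i\<in>I. k i * cip n f (h i))"
  unfolding cip_def sum_distrib_left by (subst sum.swap) (simp add: mult_ac)

lemma cip_sum_left: "cip n (\<lambda>x. \<Sum>i\<in>I. k i * h i x) f = (\<Sum>i\<in>I. cnj (k i) * cip n (h i) f)"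
  unfolding cip_def sum_distrib_left cnj_sum sum_distrib_right by (subst sum.swap) (simp add: mult_ac)

lemma cip_commute: "cip n g f = cnj (cip n f g)"
  by (simp add: cip_def mult.commute)

lemma cip_cmult: "cip n f (\<lambda>x. k * g x) = k * cip n f g" "cip n (\<lambda>x. k * f x) g = cnj k * cip n f g"
  by (simp_all add: cip_def sum_distrib_left mult_ac)

lemma cip_cong: "(\<And>i. i < n \<Longrightarrow> f i = f' i) \<Longrightarrow> (\<And>i. i < n \<Longrightarrow> g i = g' i) \<Longrightarrow> cip n f g = cip n f' g'"
  by (simp add: cip_def)

lemma cip_self: "cip n f f = of_real (\<Sum>i<n. (cmod (f i))\<^sup>2)"
  by (simp add: cip_def complex_norm_square mult.commute del: of_real_power)

lemma apply_ker_sum: "apply_ker n a (\<lambda>x. \<Sum>i\<in>I. k i * h i x) y = (\<Sum>i\<in>I. k i * apply_ker n a (h i) y)"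
  unfolding apply_ker_def sum_distrib_left by (subst sum.swap) (simp add: mult_ac)

lemma apply_ker_selfadjoint:
  assumes "\<And>i j. i < n \<Longrightarrow> j < n \<Longrightarrow> a j i = cnj (a i j)"
  shows "cip n (apply_ker n a f) g = cip n f (apply_ker n a g)"
proof -
  have "cip n (apply_ker n a f) g = (\<Sum>i<n. \<Sum>j<n. cnj (f j) * (a j i * g i))"
    unfolding cip_def apply_ker_def cnj_sum sum_distrib_right
    by (intro sum.cong refl) (simp add: assms[symmetric] mult_ac)
  also have "\<dots> = cip n f (apply_ker n a g)"
    unfolding cip_def apply_ker_def sum_distrib_left by (rule sum.swap)
  finally show ?thesis .
qed

text \<open>A left inverse of a square matrix is also a right inverse, so orthonormal columns give
  orthonormal rows.\<close>

lemma orthonormal_complete: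
  assumes "orthonormal n u" and "i < n" "j < n"
  shows "(\<Sum>c<n. u c i * cnj (u c j)) = (if i = j then 1 else 0)"
proof -
  define P where "P = mat n n (\<lambda>(i, c). u c i)"
  define Q where "Q = mat n n (\<lambda>(c, i). cnj (u c i))"
  have P: "P \<in> carrier_mat n n" "Q \<in> carrier_mat n n" by (auto simp: P_def Q_def)
  have "Q * P = 1\<^sub>m n"
    using assms(1) by (intro eq_matI)
      (auto simp: P_def Q_def scalar_prod_def orthonormal_def cip_def lessThan_atLeast0)
  then have "P * Q = 1\<^sub>m n" using mat_mult_left_right_inverse P by blast
  from arg_cong[OF this, of "\<lambda>M. M $$ (i, j)"] show ?thesis
    using assms(2,3) by (simp add: P_def Q_def scalar_prod_def lessThan_atLeast0)
qed

lemma orthonormal_expand: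
  assumes "orthonormal n u" and "i < n"
  shows "f i = (\<Sum>c<n. cip n (u c) f * u c i)"
proof -
  have "(\<Sum>c<n. cip n (u c) f * u c i) = (\<Sum>j<n. f j * (\<Sum>c<n. u c i * cnj (u c j)))"
    unfolding cip_def sum_distrib_left sum_distrib_right by (subst sum.swap) (simp add: mult_ac)
  also have "\<dots> = (\<Sum>j<n. if i = j then f j else 0)"
    by (intro sum.cong refl) (simp add: orthonormal_complete[OF assms])
  also have "\<dots> = f i" using assms(2) by simp
  finally show ?thesis by simp
qed

text \<open>Basis completion and Gram-Schmidt both keep the first vector. This provides the basis in
  which \<open>hermitian_eigenbasis\<close> splits off an eigenvector.\<close>

lemma orthonormal_extend:
  assumes "cip n v v = 1"
  shows "\<exists>u. orthonormal n u \<and> (\<forall>i<n. u 0 i = v i)"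
proof -
  define vv where "vv = vec n v"
  have vv: "vv \<in> carrier_vec n" by (simp add: vv_def)
  have n: "n \<noteq> 0" using assms by (cases n) (auto simp: cip_def)
  have v0: "vv \<noteq> 0\<^sub>v n"
  proof
    assume "vv = 0\<^sub>v n"
    then have "v i = 0" if "i < n" for i using that by (metis vv_def index_vec index_zero_vec(1))
    then show False using assms by (simp add: cip_def)
  qed
  interpret cof_vec_space n "TYPE(complex)" .
  define b where "b = basis_completion vv"
  define ws where "ws = gram_schmidt n b"
  from basis_completion[OF vv v0, folded b_def]
  have span_b: "span (set b) = carrier_vec n" and dist_b: "distinct b"
    and indep: "\<not> lin_dep (set b)" and b: "set b \<subseteq> carrier_vec n" and hdb: "hd b = vv"
    and len_b: "length b = n" by auto
  from hdb len_b n obtain vs where bv: "b = vv # vs" by (cases b, auto)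
  from gram_schmidt_result[OF b dist_b indep refl, folded ws_def]
  have ws: "set ws \<subseteq> carrier_vec n" "corthogonal ws" "length ws = n"
    by (auto simp: len_b)
  from gram_schmidt_hd[OF vv, of vs, folded bv] have hdws: "hd ws = vv" unfolding ws_def .
  have ws0: "ws ! 0 = vv" using hdws ws(3) n by (cases ws) auto
  define r where "r c i = vec_index (ws ! c) i" for c i
  have dim: "dim_vec (ws ! c) = n" if "c < n" for c using ws(1,3) that by (metis carrier_vecD nth_mem subsetD)
  have ip: "cip n (r c) (r d) = (ws ! d) \<bullet>c (ws ! c)" if "c < n" "d < n" for c d
    using that dim by (simp add: cip_def r_def scalar_prod_def lessThan_atLeast0 mult.commute)
  have orth: "cip n (r c) (r d) = 0 \<longleftrightarrow> c \<noteq> d" if "c < n" "d < n" for c d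
    using corthogonalD[OF ws(2), of d c] that ws(3) by (auto simp: ip)
  define N where "N c = (\<Sum>i<n. (cmod (r c i))\<^sup>2)" for c
  have N: "cip n (r c) (r c) = of_real (N c)" for c by (simp add: N_def cip_self)
  have N0: "N c > 0" if "c < n" for c
  proof -
    have "N c \<noteq> 0" using orth[OF that that] N[of c] by auto
    moreover have "N c \<ge> 0" unfolding N_def by (intro sum_nonneg) auto
    ultimately show ?thesis by simp
  qed
  \<comment> \<open>\<open>gram_schmidt\<close> orthogonalises without normalising. The first vector
    already has norm 1 and is unchanged by the rescaling.\<close>
  define u where "u c i = of_real (1 / sqrt (N c)) * r c i" for c i
  have "orthonormal n u"
    unfolding orthonormal_def
  proof (intro allI impI)
    fix c d assume cd: "c < n" "d < n"
    have "cip n (u c) (u d) = of_real (1 / sqrt (N d)) * (of_real (1 / sqrt (N c)) * cip n (r c) (r d))"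
      unfolding u_def[abs_def] cip_cmult by simp
    then show "cip n (u c) (u d) = (if c = d then 1 else 0)"
      using orth[OF cd] N0[OF cd(1)] by (auto simp: N simp flip: of_real_mult)
  qed
  moreover have "u 0 i = v i" if "i < n" for i
  proof -
    have r: "r 0 i = v i" if "i < n" for i using that by (simp add: r_def ws0 vv_def)
    have "of_real (N 0) = cip n v v" unfolding N[symmetric] by (rule cip_cong) (auto simp: r)
    then have "N 0 = 1" using assms by simp
    then show ?thesis using that r by (simp add: u_def)
  qed
  ultimately show ?thesis by (intro exI conjI) auto
qed

text \<open>The characteristic polynomial splits over the complex numbers and has a root because its
  degree \<open>n\<close> is positive.\<close>

lemma kernel_eigenvector:
  assumes "n \<noteq> 0"
  shows "\<exists>v e. cip n v v = 1 \<and> (\<forall>i<n. apply_ker n a v i = e * v i)"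
proof -
  define A where "A = mat n n (\<lambda>(i, j). a i j)"
  have A: "A \<in> carrier_mat n n" by (simp add: A_def)
  obtain es where es: "char_poly A = (\<Prod>e\<leftarrow>es. [:- e, 1:])" "length es = n"
    using char_poly_factorized[OF A] by blast
  have "es \<noteq> []" using es(2) assms by auto
  then have "hd es \<in> set es" by simp
  then have "poly (char_poly A) (hd es) = 0" unfolding es(1) by (rule linear_poly_root)
  moreover define e where "e = hd es"
  ultimately have "eigenvalue A e" using eigenvalue_root_char_poly[OF A] by simp
  then obtain x where x: "x \<in> carrier_vec n" "x \<noteq> 0\<^sub>v n" "A *\<^sub>v x = e \<cdot>\<^sub>v x"
    using A by (auto simp: eigenvalue_def eigenvector_def)
  define N where "N = (\<Sum>i<n. (cmod (vec_index x i))\<^sup>2)"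
  have "N \<noteq> 0"
  proof
    assume "N = 0"
    then have "vec_index x i = 0" if "i < n" for i
      using that unfolding N_def by (subst (asm) sum_nonneg_eq_0_iff) auto
    then show False using x by (auto intro!: eq_vecI)
  qed
  moreover have "N \<ge> 0" unfolding N_def by (intro sum_nonneg) auto
  ultimately have N: "N > 0" by simp
  define v where "v i = of_real (1 / sqrt N) * vec_index x i" for i
  have "cip n v v = of_real (1 / sqrt N) * (of_real (1 / sqrt N) * of_real N)"
    unfolding v_def[abs_def] cip_cmult N_def cip_self by simp
  then have "cip n v v = 1" using N by (simp flip: of_real_mult)
  moreover have "apply_ker n a v i = e * v i" if "i < n" for i
  proof -
    have "(\<Sum>j<n. a i j * vec_index x j) = e * vec_index x i"
      using arg_cong[OF x(3), of "\<lambda>v. vec_index v i"] that x(1) A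
      by (simp add: A_def scalar_prod_def lessThan_atLeast0)
    then have "of_real (1 / sqrt N) * (\<Sum>j<n. a i j * vec_index x j) = of_real (1 / sqrt N) * (e * vec_index x i)"
      by simp
    then show ?thesis by (simp add: apply_ker_def v_def sum_distrib_left mult_ac)
  qed
  ultimately show ?thesis by (intro exI conjI) auto
qed

text \<open>Induction on the dimension: complete a unit eigenvector to an orthonormal basis,
  diagonalise the compression to its complement, and lift the eigenvectors back.\<close>

theorem hermitian_eigenbasis:
  assumes "\<And>i j. i < n \<Longrightarrow> j < n \<Longrightarrow> a j i = cnj (a i j)"
  shows "\<exists>(l :: nat \<Rightarrow> real) u. orthonormal n u \<and> (\<forall>c<n. \<forall>i<n. apply_ker n a (u c) i = of_real (l c) * u c i)"
  using assms
proof (induction n arbitrary: a)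
  case 0
  then show ?case by (simp add: orthonormal_def)
next
  case (Suc n)
  let ?n = "Suc n"
  obtain v e where v: "cip ?n v v = 1" and e: "\<And>i. i < ?n \<Longrightarrow> apply_ker ?n a v i = e * v i"
    using kernel_eigenvector[of ?n a] by auto
  obtain W where W: "orthonormal ?n W" and W0: "\<And>i. i < ?n \<Longrightarrow> W 0 i = v i"
    using orthonormal_extend[OF v] by blast
  have Wo: "cip ?n (W c) (W d) = (if c = d then 1 else 0)" if "c < ?n" "d < ?n" for c d
    using W that by (simp add: orthonormal_def)
  have sa: "cip ?n (apply_ker ?n a f) g = cip ?n f (apply_ker ?n a g)" for f g
    by (rule apply_ker_selfadjoint) (rule Suc.prems)
  have aW0: "apply_ker ?n a (W 0) i = e * W 0 i" if "i < ?n" for i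
  proof -
    have "apply_ker ?n a (W 0) i = apply_ker ?n a v i"
      unfolding apply_ker_def by (intro sum.cong refl) (simp add: W0)
    then show ?thesis using that e W0 by simp
  qed
  \<comment> \<open>Self-adjointness equates the two ways of pairing \<open>W 0\<close> with its
    image, with values \<open>e\<close> and \<open>cnj e\<close>; so the eigenvalue is real.\<close>
  have "cip ?n (W 0) (apply_ker ?n a (W 0)) = cip ?n (W 0) (\<lambda>x. e * W 0 x)"
    by (rule cip_cong) (auto simp: aW0)
  moreover have "cip ?n (apply_ker ?n a (W 0)) (W 0) = cip ?n (\<lambda>x. e * W 0 x) (W 0)"
    by (rule cip_cong) (auto simp: aW0)
  ultimately have "cnj e = e" using sa[of "W 0" "W 0"] by (simp add: Wo cip_cmult)
  then have eR: "e = of_real (Re e)" by (metis Reals_cnj_iff of_real_Re)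
  \<comment> \<open>The compression of \<open>a\<close> to the complement of \<open>W 0\<close>, in
    the basis \<open>W 1, ..., W n\<close>.\<close>
  define b where "b i j = cip ?n (W (Suc i)) (apply_ker ?n a (W (Suc j)))" for i j
  have "b j i = cnj (b i j)" for i j
    unfolding b_def by (subst cip_commute) (simp add: sa)
  from Suc.IH[of b, OF this] obtain l u where u: "orthonormal n u"
    and l: "\<And>c i. c < n \<Longrightarrow> i < n \<Longrightarrow> apply_ker n b (u c) i = of_real (l c) * u c i" by blast
  have uo: "cip n (u c) (u d) = (if c = d then 1 else 0)" if "c < n" "d < n" for c d
    using u that by (simp add: orthonormal_def)
  define U where "U c = (case c of 0 \<Rightarrow> W 0 | Suc c \<Rightarrow> (\<lambda>x. \<Sum>i<n. u c i * W (Suc i) x))" for c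
  define m where "m c = (case c of 0 \<Rightarrow> Re e | Suc c \<Rightarrow> l c)" for c
  have U0: "U 0 = W 0" and US: "U (Suc c) = (\<lambda>x. \<Sum>i<n. u c i * W (Suc i) x)" for c
    by (simp_all add: U_def)
  have S0: "cip ?n (U 0) (U (Suc c)) = 0" for c
    unfolding U0 US cip_sum_right by (intro sum.neutral) (simp add: Wo)
  have SS: "cip ?n (U (Suc c)) (U (Suc d)) = cip n (u c) (u d)" for c d
  proof -
    have "cip ?n (U (Suc c)) (U (Suc d)) = (\<Sum>j<n. u d j * (\<Sum>i<n. cnj (u c i) * (if i = j then 1 else 0)))"
      unfolding US cip_sum_right cip_sum_left by (intro sum.cong refl) (simp add: Wo)
    also have "\<dots> = cip n (u c) (u d)" by (simp add: cip_def if_distrib mult.commute cong: if_cong)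
    finally show ?thesis .
  qed
  have "orthonormal ?n U"
    unfolding orthonormal_def
  proof (intro allI impI)
    fix c d assume "c < ?n" "d < ?n"
    then show "cip ?n (U c) (U d) = (if c = d then 1 else 0)"
      using S0 SS uo Wo[of 0 0] by (cases c; cases d) (auto simp: U0 cip_commute[of ?n "U (Suc _)" "W 0"])
  qed
  moreover have "apply_ker ?n a (U c) i = of_real (m c) * U c i" if c: "c < ?n" and i: "i < ?n" for c i
  proof (cases c)
    case 0
    then show ?thesis using aW0[OF i] eR by (simp add: U0 m_def)
  next
    case (Suc d)
    have d: "d < n" using c Suc by simp
    \<comment> \<open>The complement is invariant: since \<open>W 0\<close> is an eigenvector of a
      self-adjoint kernel, the image has no \<open>W 0\<close> component. Hence \<open>b\<close>
      describes \<open>a\<close> there completely.\<close>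
    have aW: "apply_ker ?n a (W (Suc j)) i = (\<Sum>k<n. b k j * W (Suc k) i)" if "j < n" for j
    proof -
      have "cip ?n (W 0) (apply_ker ?n a (W (Suc j))) = cip ?n (apply_ker ?n a (W 0)) (W (Suc j))"
        by (simp add: sa)
      also have "\<dots> = cip ?n (\<lambda>x. e * W 0 x) (W (Suc j))" by (rule cip_cong) (auto simp: aW0)
      also have "\<dots> = 0" using that by (simp add: cip_cmult Wo)
      finally show ?thesis
        using orthonormal_expand[OF W i, of "apply_ker ?n a (W (Suc j))"]
        by (simp add: sum.lessThan_Suc_shift b_def del: sum.lessThan_Suc)
    qed
    have "apply_ker ?n a (U c) i = (\<Sum>j<n. u d j * (\<Sum>k<n. b k j * W (Suc k) i))"
      unfolding Suc US apply_ker_sum by (intro sum.cong refl) (simp add: aW)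
    also have "\<dots> = (\<Sum>k<n. apply_ker n b (u d) k * W (Suc k) i)"
      unfolding apply_ker_def sum_distrib_left sum_distrib_right by (subst sum.swap) (simp add: mult_ac)
    also have "\<dots> = of_real (m c) * U c i"
      by (simp add: Suc US m_def l d sum_distrib_left mult_ac)
    finally show ?thesis .
  qed
  ultimately show ?case by blast
qed

lemma sum_rotate:
  "(\<Sum>i\<in>A. \<Sum>j\<in>B. \<Sum>c\<in>C. F i j c) = (\<Sum>c\<in>C. \<Sum>i\<in>A. \<Sum>j\<in>B. F i j c)"
proof -
  have "(\<Sum>i\<in>A. \<Sum>j\<in>B. \<Sum>c\<in>C. F i j c) = (\<Sum>i\<in>A. \<Sum>c\<in>C. \<Sum>j\<in>B. F i j c)"
    by (intro sum.cong refl sum.swap)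
  also have "\<dots> = (\<Sum>c\<in>C. \<Sum>i\<in>A. \<Sum>j\<in>B. F i j c)" by (rule sum.swap)
  finally show ?thesis .
qed

section \<open>Spectral decompositions, positivity and Schatten norms of matrices\<close>

definition spectral :: "nat \<Rightarrow> complex mat \<Rightarrow> (nat \<Rightarrow> real) \<Rightarrow> (nat \<Rightarrow> nat \<Rightarrow> complex) \<Rightarrow> bool" where
  "spectral n A l u \<longleftrightarrow> A \<in> carrier_mat n n \<and> orthonormal n u \<and>
     (\<forall>i<n. \<forall>j<n. A $$ (i, j) = (\<Sum>c<n. of_real (l c) * (u c i * cnj (u c j))))"

definition bform :: "nat \<Rightarrow> complex mat \<Rightarrow> (nat \<Rightarrow> complex) \<Rightarrow> (nat \<Rightarrow> complex) \<Rightarrow> complex" where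
  "bform n A f g = (\<Sum>i<n. \<Sum>j<n. cnj (f i) * g j * A $$ (i, j))"

abbreviation qform :: "nat \<Rightarrow> complex mat \<Rightarrow> (nat \<Rightarrow> complex) \<Rightarrow> complex" where
  "qform n A f \<equiv> bform n A f f"

definition hermitian_mat :: "nat \<Rightarrow> complex mat \<Rightarrow> bool" where
  "hermitian_mat n A \<longleftrightarrow> A \<in> carrier_mat n n \<and> (\<forall>i<n. \<forall>j<n. A $$ (j, i) = cnj (A $$ (i, j)))"

lemma psd_iff:
  "psd n A \<longleftrightarrow> hermitian_mat n A \<and> (\<forall>f. Im (qform n A f) = 0 \<and> 0 \<le> Re (qform n A f))"
proof -
  have herm: "cadj A = A \<longleftrightarrow> (\<forall>i<n. \<forall>j<n. A $$ (j, i) = cnj (A $$ (i, j)))"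
    if A: "A \<in> carrier_mat n n"
  proof
    assume h: "cadj A = A"
    show "\<forall>i<n. \<forall>j<n. A $$ (j, i) = cnj (A $$ (i, j))"
    proof (intro allI impI)
      fix i j assume "i < n" "j < n"
      then have "cadj A $$ (j, i) = cnj (A $$ (i, j))" using A by (simp add: cadj_def)
      then show "A $$ (j, i) = cnj (A $$ (i, j))" by (simp only: h)
    qed
  next
    assume h: "\<forall>i<n. \<forall>j<n. A $$ (j, i) = cnj (A $$ (i, j))"
    have "cnj (A $$ (j, i)) = A $$ (i, j)" if "i < n" "j < n" for i j
      using h that by metis
    then show "cadj A = A" using A by (intro eq_matI) (auto simp: cadj_def)
  qed
  have qf: "conjugate v \<bullet> (A *\<^sub>v v) = qform n A (vec_index v)"
    if "A \<in> carrier_mat n n" "v \<in> carrier_vec n" for v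
    using that by (simp add: scalar_prod_def bform_def lessThan_atLeast0 sum_distrib_left mult_ac)
  have qf': "qform n A (vec_index (vec n f)) = qform n A f" for f
    unfolding bform_def by (intro sum.cong refl) simp
  show ?thesis
    unfolding psd_def hermitian_mat_def using herm qf qf'
    by (metis vec_carrier)
qed

lemma psd_carrier: "psd n A \<Longrightarrow> A \<in> carrier_mat n n"
  by (simp add: psd_def)

lemma psd_hermitian: "psd n A \<Longrightarrow> hermitian_mat n A"
  by (simp add: psd_iff)

text \<open>Inserting the completeness relation of the eigenbasis turns the eigenvalue equations
  into an expansion of the entries.\<close>

lemma hermitian_spectral:
  assumes "hermitian_mat n A"
  shows "\<exists>l u. spectral n A l u"
proof -
  define a where "a i j = A $$ (i, j)" for i j
  have h: "a j i = cnj (a i j)" if "i < n" "j < n" for i j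
    using assms that unfolding hermitian_mat_def a_def by blast
  obtain l :: "nat \<Rightarrow> real" and u where u: "orthonormal n u"
    and l: "\<And>c i. c < n \<Longrightarrow> i < n \<Longrightarrow> apply_ker n a (u c) i = of_real (l c) * u c i"
    using hermitian_eigenbasis[of n a] h by blast
  have "a i j = (\<Sum>c<n. of_real (l c) * (u c i * cnj (u c j)))" if ij: "i < n" "j < n" for i j
  proof -
    have "(\<Sum>c<n. of_real (l c) * (u c i * cnj (u c j))) = (\<Sum>c<n. apply_ker n a (u c) i * cnj (u c j))"
      by (intro sum.cong refl) (simp add: l ij)
    also have "\<dots> = (\<Sum>k<n. a i k * (\<Sum>c<n. u c k * cnj (u c j)))"
      unfolding apply_ker_def sum_distrib_left sum_distrib_right by (subst sum.swap) (simp add: mult_ac)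
    also have "\<dots> = (\<Sum>k<n. if k = j then a i k else 0)"
      by (intro sum.cong refl) (simp add: orthonormal_complete[OF u _ ij(2)])
    also have "\<dots> = a i j" using ij by simp
    finally show ?thesis by simp
  qed
  then have "spectral n A l u" using assms u by (simp add: spectral_def hermitian_mat_def a_def)
  then show ?thesis by blast
qed

lemma spectral_bform:
  assumes "spectral n A l u"
  shows "bform n A f g = (\<Sum>c<n. of_real (l c) * (cip n f (u c) * cip n (u c) g))"
proof -
  have "bform n A f g = (\<Sum>i<n. \<Sum>j<n. \<Sum>c<n. of_real (l c) * ((cnj (f i) * u c i) * (cnj (u c j) * g j)))"
    unfolding bform_def using assms
    by (intro sum.cong refl) (simp add: spectral_def sum_distrib_left mult_ac)
  also have "\<dots> = (\<Sum>c<n. of_real (l c) * ((\<Sum>i<n. cnj (f i) * u c i) * (\<Sum>j<n. cnj (u c j) * g j)))"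
    unfolding sum_product unfolding sum_distrib_left by (rule sum_rotate)
  finally show ?thesis by (simp add: cip_def)
qed

lemma spectral_qform:
  assumes "spectral n A l u"
  shows "qform n A f = of_real (\<Sum>c<n. l c * (cmod (cip n (u c) f))\<^sup>2)"
proof -
  have "qform n A f = (\<Sum>c<n. of_real (l c) * (cip n (u c) f * cnj (cip n (u c) f)))"
    unfolding spectral_bform[OF assms] by (subst cip_commute) (simp add: mult.commute)
  also have "\<dots> = of_real (\<Sum>c<n. l c * (cmod (cip n (u c) f))\<^sup>2)"
    by (simp add: complex_norm_square del: of_real_power)
  finally show ?thesis .
qed

lemma spectral_hermitian: "spectral n A l u \<Longrightarrow> hermitian_mat n A"
  by (auto simp: spectral_def hermitian_mat_def mult.commute)

lemma spectral_psd:
  assumes "spectral n A l u" "\<And>c. c < n \<Longrightarrow> 0 \<le> l c"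
  shows "psd n A"
  unfolding psd_iff spectral_qform[OF assms(1)]
  using assms(2) by (auto intro!: sum_nonneg spectral_hermitian[OF assms(1)])

lemma spectral_qform_eigenvector:
  assumes "spectral n A l u" "d < n"
  shows "qform n A (u d) = of_real (l d)"
proof -
  have "(cmod (cip n (u c) (u d)))\<^sup>2 = (if c = d then 1 else 0)" if "c < n" for c
    using assms that by (simp add: spectral_def orthonormal_def)
  then have "(\<Sum>c<n. l c * (cmod (cip n (u c) (u d)))\<^sup>2) = (\<Sum>c<n. if c = d then l c else 0)"
    by (intro sum.cong refl) auto
  then show ?thesis using assms by (simp add: spectral_qform[OF assms(1)] del: of_real_sum)
qed

lemma psd_spectral:
  assumes "psd n A"
  shows "\<exists>l u. spectral n A l u \<and> (\<forall>c<n. 0 \<le> l c)"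
proof -
  obtain l u where s: "spectral n A l u" using hermitian_spectral assms psd_hermitian by blast
  then have "0 \<le> l c" if "c < n" for c
    using assms spectral_qform_eigenvector[OF s that] unfolding psd_iff by (metis Re_complex_of_real)
  then show ?thesis using s by blast
qed

lemma spectral_trace:
  assumes "spectral n A l u"
  shows "mtrace A = of_real (\<Sum>c<n. l c)"
proof -
  have "dim_row A = n" using assms by (auto simp: spectral_def)
  then have "mtrace A = (\<Sum>i<n. \<Sum>c<n. of_real (l c) * (u c i * cnj (u c i)))"
    using assms by (simp add: mtrace_def spectral_def)
  also have "\<dots> = (\<Sum>c<n. of_real (l c) * cip n (u c) (u c))"
    by (subst sum.swap) (simp add: cip_def sum_distrib_left mult_ac)
  also have "\<dots> = of_real (\<Sum>c<n. l c)"
    unfolding of_real_sum using assms by (intro sum.cong refl) (simp add: spectral_def orthonormal_def)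
  finally show ?thesis .
qed

lemma spectral_cadj_mult:
  assumes "spectral n A l u"
  shows "spectral n (cadj A * A) (\<lambda>c. (l c)\<^sup>2) u"
proof -
  have A: "A \<in> carrier_mat n n" and u: "orthonormal n u" using assms by (auto simp: spectral_def)
  have "(cadj A * A) $$ (i, j) = (\<Sum>c<n. of_real ((l c)\<^sup>2) * (u c i * cnj (u c j)))"
    if ij: "i < n" "j < n" for i j
  proof -
    have "(cadj A * A) $$ (i, j) = (\<Sum>k<n. cnj (A $$ (k, i)) * A $$ (k, j))"
      using A ij by (simp add: cadj_def scalar_prod_def lessThan_atLeast0)
    also have "\<dots> = (\<Sum>k<n. (\<Sum>c<n. of_real (l c) * (u c i * cnj (u c k))) * (\<Sum>d<n. of_real (l d) * (u d k * cnj (u d j))))"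
      using assms ij by (intro sum.cong refl) (simp add: spectral_def mult_ac)
    also have "\<dots> = (\<Sum>k<n. \<Sum>c<n. \<Sum>d<n. of_real (l c) * of_real (l d) * u c i * cnj (u d j) * (cnj (u c k) * u d k))"
      unfolding sum_product by (simp add: mult_ac)
    also have "\<dots> = (\<Sum>c<n. \<Sum>d<n. of_real (l c) * of_real (l d) * u c i * cnj (u d j) * cip n (u c) (u d))"
      unfolding cip_def sum_distrib_left by (rule sum_rotate[symmetric])
    also have "\<dots> = (\<Sum>c<n. \<Sum>d<n. if c = d then of_real (l c) * of_real (l d) * u c i * cnj (u d j) else 0)"
      using u by (intro sum.cong refl) (simp add: orthonormal_def)
    also have "\<dots> = (\<Sum>c<n. of_real ((l c)\<^sup>2) * (u c i * cnj (u c j)))"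
      by (simp add: power2_eq_square mult_ac)
    finally show ?thesis .
  qed
  then show ?thesis using A u by (auto simp: spectral_def cadj_def)
qed

text \<open>The eigenvectors are the columns of a matrix \<open>P\<close> with inverse
  \<open>Q\<close>, which makes \<open>A\<close> similar to a diagonal matrix.\<close>

lemma spectral_char_poly:
  assumes "spectral n A l u"
  shows "char_poly A = (\<Prod>z\<leftarrow>map (\<lambda>c. of_real (l c)) [0..<n]. [:- z, 1:])"
proof -
  have A: "A \<in> carrier_mat n n" and u: "orthonormal n u" using assms by (auto simp: spectral_def)
  define D where "D = mat n n (\<lambda>(i, j). if i = j then complex_of_real (l i) else 0)"
  define P where "P = mat n n (\<lambda>(i, c). u c i)"
  define Q where "Q = mat n n (\<lambda>(c, i). cnj (u c i))"
  have C: "P \<in> carrier_mat n n" "Q \<in> carrier_mat n n" "D \<in> carrier_mat n n"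
    by (auto simp: P_def Q_def D_def)
  have QP: "Q * P = 1\<^sub>m n"
    using u by (intro eq_matI)
      (auto simp: P_def Q_def scalar_prod_def orthonormal_def cip_def lessThan_atLeast0)
  then have PQ: "P * Q = 1\<^sub>m n" using mat_mult_left_right_inverse C by blast
  have PD: "(P * D) $$ (i, c) = u c i * of_real (l c)" if "i < n" "c < n" for i c
  proof -
    have "(P * D) $$ (i, c) = (\<Sum>k<n. u k i * (if k = c then of_real (l k) else 0))"
      using that by (simp add: P_def D_def scalar_prod_def lessThan_atLeast0)
    also have "\<dots> = (\<Sum>k<n. if k = c then u k i * of_real (l k) else 0)"
      by (intro sum.cong refl) simp
    finally show ?thesis using that by simp
  qed
  have "A = P * D * Q"
  proof (rule eq_matI)
    fix i j assume "i < dim_row (P * D * Q)" "j < dim_col (P * D * Q)"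
    then have ij: "i < n" "j < n" using C by auto
    have "(P * D * Q) $$ (i, j) = row (P * D) i \<bullet> col Q j"
      using ij C by (intro index_mult_mat(1)) auto
    also have "\<dots> = (\<Sum>c<n. (P * D) $$ (i, c) * Q $$ (c, j))"
      using ij C by (simp add: scalar_prod_def lessThan_atLeast0)
    also have "\<dots> = A $$ (i, j)"
      using ij assms by (simp add: PD Q_def spectral_def mult_ac)
    finally show "A $$ (i, j) = (P * D * Q) $$ (i, j)" by simp
  qed (use A C in auto)
  then have "similar_mat_wit A D P Q" using A C PQ QP by (intro similar_mat_witI[of _ _ n])
  then have "similar_mat A D" by (auto simp: similar_mat_def)
  then have "char_poly A = char_poly D" by (rule char_poly_similar)
  also have "\<dots> = (\<Prod>z\<leftarrow>diag_mat D. [:- z, 1:])"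
    by (rule char_poly_upper_triangular[OF C(3)]) (auto simp: D_def)
  also have "diag_mat D = map (\<lambda>c. of_real (l c)) [0..<n]"
    by (auto simp: diag_mat_def D_def)
  finally show ?thesis .
qed

lemma prod_list_linear_nonzero: "(\<Prod>z\<leftarrow>xs. [:- z, 1:]) \<noteq> (0 :: complex poly)"
  by (induction xs) (auto simp: prod_list_zero_iff simp del: mult_pCons_left)

text \<open>Identifies algebraic multiplicity with repetition in the list of eigenvalues. With
  \<open>sum_count_list\<close>, the sum over distinct roots in \<open>schatten\<close> becomes a
  sum over all eigenvalue indices.\<close>

lemma order_prod_list_linear: "Polynomial.order z (\<Prod>z\<leftarrow>xs. [:- z, 1 :: complex:]) = count_list xs z"
proof (induction xs)
  case Nil
  then show ?case by (simp add: order_root order_0I)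
next
  case (Cons x xs)
  have "Polynomial.order z ([:- x, 1:] * (\<Prod>z\<leftarrow>xs. [:- z, 1:])) = Polynomial.order z [:- x, 1:] + count_list xs z"
    using prod_list_linear_nonzero[of xs] Cons by (subst order_mult) (auto simp del: mult_pCons_left)
  then show ?case by (auto simp: order_linear' simp del: mult_pCons_left)
qed

lemma sum_count_list:
  "(\<Sum>z\<in>set xs. real (count_list xs z) * f z) = sum_list (map f xs)"
proof (induction xs)
  case (Cons x xs)
  have "(\<Sum>z\<in>set (x # xs). real (count_list (x # xs) z) * f z)
      = (\<Sum>z\<in>insert x (set xs). real (count_list xs z) * f z + (if x = z then f z else 0))"
    by (intro sum.cong) (auto simp: algebra_simps)
  also have "\<dots> = (\<Sum>z\<in>insert x (set xs). real (count_list xs z) * f z) + f x"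
    by (simp add: sum.distrib del: sum.insert_if)
  also have "(\<Sum>z\<in>insert x (set xs). real (count_list xs z) * f z)
      = (\<Sum>z\<in>set xs. real (count_list xs z) * f z)"
    by (intro sum.mono_neutral_right) (auto simp: count_list_0_iff)
  finally show ?case using Cons by simp
qed simp

text \<open>\<open>cadj A * A\<close> has the eigenvalues \<open>(l c)\<^sup>2\<close>, whose power
  \<open>p / 2\<close> is \<open>\<bar>l c\<bar> powr p\<close>. From here on norms are computed
  from eigenvalues alone.\<close>

theorem spectral_schatten:
  assumes "spectral n A l u"
  shows "schatten p A = (\<Sum>c<n. \<bar>l c\<bar> powr p) powr (1 / p)"
proof -
  define xs where "xs = map (\<lambda>c. complex_of_real ((l c)\<^sup>2)) [0..<n]"
  define q where "q = char_poly (cadj A * A)"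
  have q: "q = (\<Prod>z\<leftarrow>xs. [:- z, 1:])"
    unfolding q_def xs_def by (rule spectral_char_poly[OF spectral_cadj_mult[OF assms]])
  have "{z. poly q z = 0} = set xs" unfolding q by (auto simp: poly_prod_list_zero_iff)
  then have "(\<Sum>z\<in>{z. poly q z = 0}. real (Polynomial.order z q) * (Re z) powr (p / 2))
      = (\<Sum>z\<in>set xs. real (count_list xs z) * (Re z) powr (p / 2))"
    unfolding q order_prod_list_linear by simp
  also have "\<dots> = sum_list (map (\<lambda>z. (Re z) powr (p / 2)) xs)"
    by (rule sum_count_list)
  also have "\<dots> = (\<Sum>c<n. (Re (complex_of_real ((l c)\<^sup>2))) powr (p / 2))"
    by (simp only: xs_def map_map o_def sum_set_upt_conv_sum_list_nat[symmetric] lessThan_atLeast0 set_upt)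
  also have "\<dots> = (\<Sum>c<n. \<bar>l c\<bar> powr p)"
  proof (intro sum.cong refl)
    fix c
    have "((l c)\<^sup>2) powr (p / 2) = (\<bar>l c\<bar> powr 2) powr (p / 2)" by simp
    also have "\<dots> = \<bar>l c\<bar> powr p" by (simp only: powr_powr) simp
    finally show "(Re (complex_of_real ((l c)\<^sup>2))) powr (p / 2) = \<bar>l c\<bar> powr p" by simp
  qed
  finally show ?thesis unfolding schatten_def Let_def q_def[symmetric] by simp
qed

section \<open>Kronecker products and states\<close>

lemma sum_prod_index:
  "(\<Sum>z<m * n :: nat. F z) = (\<Sum>i<m. \<Sum>j<n. F (i * n + j))"
  by (simp add: sum_mult_product add.commute)

lemma prod_index_less: "i < m \<Longrightarrow> j < n \<Longrightarrow> i * n + j < m * (n :: nat)"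
proof -
  assume "i < m" "j < n"
  then have "i * n + j < Suc i * n" by simp
  also have "\<dots> \<le> m * n" using \<open>i < m\<close> by (intro mult_le_mono1) simp
  finally show ?thesis .
qed

lemma prod_index_div_mod: "z < m * n \<Longrightarrow> z div n < m \<and> z mod n < (n :: nat)"
  by (metis gr_zeroI less_mult_imp_div_less mod_less_divisor mult_0_right not_less_zero)

lemma kron_carrier: "A \<in> carrier_mat m m \<Longrightarrow> B \<in> carrier_mat n n \<Longrightarrow> kron A B \<in> carrier_mat (m * n) (m * n)"
  by (simp add: kron_def)

lemma kron_index:
  assumes "A \<in> carrier_mat m m" "B \<in> carrier_mat n n" "a < m" "a' < m" "b < n" "b' < n"
  shows "kron A B $$ (a * n + b, a' * n + b') = A $$ (a, a') * B $$ (b, b')"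
  using assms by (simp add: kron_def prod_index_less)

text \<open>Products of the two eigenbases diagonalise the Kronecker product, with
  \<open>z div n\<close> and \<open>z mod n\<close> decoding the pair of indices. Positivity, trace
  and Schatten norm of \<open>kron\<close> are read off from this.\<close>

lemma kron_spectral:
  assumes A: "spectral m A l u" and B: "spectral n B l' u'"
  shows "spectral (m * n) (kron A B) (\<lambda>z. l (z div n) * l' (z mod n))
    (\<lambda>z x. u (z div n) (x div n) * u' (z mod n) (x mod n))"
proof -
  let ?u = "\<lambda>z x. u (z div n) (x div n) * u' (z mod n) (x mod n)"
  have c: "A \<in> carrier_mat m m" "B \<in> carrier_mat n n" using A B by (auto simp: spectral_def)
  have "cip (m * n) (?u z) (?u z') = cip m (u (z div n)) (u (z' div n)) * cip n (u' (z mod n)) (u' (z' mod n))" for z z'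
    by (simp add: cip_def sum_prod_index sum_product mult_ac)
  then have "cip (m * n) (?u z) (?u z') = (if z = z' then 1 else 0)" if "z < m * n" "z' < m * n" for z z'
    using A B prod_index_div_mod[OF that(1)] prod_index_div_mod[OF that(2)]
    by (auto simp: spectral_def orthonormal_def) (metis div_mult_mod_eq)
  moreover have "kron A B $$ (x, y) = (\<Sum>z<m * n. of_real (l (z div n) * l' (z mod n)) * (?u z x * cnj (?u z y)))"
    if "x < m * n" "y < m * n" for x y
    using A B that c prod_index_div_mod[OF that(1)] prod_index_div_mod[OF that(2)]
    by (simp add: kron_def sum_prod_index spectral_def sum_product mult_ac)
  ultimately show ?thesis using c kron_carrier by (auto simp: spectral_def orthonormal_def)
qed

lemma kron_psd:
  assumes "psd m A" "psd n B"
  shows "psd (m * n) (kron A B)"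
proof -
  obtain l u where A: "spectral m A l u" "\<And>c. c < m \<Longrightarrow> 0 \<le> l c"
    using psd_spectral assms(1) by blast
  obtain l' u' where B: "spectral n B l' u'" "\<And>c. c < n \<Longrightarrow> 0 \<le> l' c"
    using psd_spectral assms(2) by blast
  show ?thesis
    using prod_index_div_mod by (intro spectral_psd[OF kron_spectral[OF A(1) B(1)]]) (auto intro!: A(2) B(2) mult_nonneg_nonneg)
qed

lemma kron_density:
  assumes "density m A" "density n B"
  shows "density (m * n) (kron A B)"
proof -
  obtain l u where A: "spectral m A l u" using psd_spectral assms(1) unfolding density_def by blast
  obtain l' u' where B: "spectral n B l' u'" using psd_spectral assms(2) unfolding density_def by blast
  have "psd (m * n) (kron A B)" using kron_psd assms by (simp add: density_def)
  moreover have "mtrace (kron A B) = mtrace A * mtrace B"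
    unfolding spectral_trace[OF A] spectral_trace[OF B] spectral_trace[OF kron_spectral[OF A B]]
    by (simp add: sum_prod_index sum_product)
  ultimately show ?thesis using assms by (simp add: density_def)
qed

lemma schatten_kron:
  assumes "psd m A" "psd n B"
  shows "schatten p (kron A B) = schatten p A * schatten p B"
proof -
  obtain l u where A: "spectral m A l u" using psd_spectral assms(1) by blast
  obtain l' u' where B: "spectral n B l' u'" using psd_spectral assms(2) by blast
  have "(\<Sum>z<m * n. \<bar>l (z div n) * l' (z mod n)\<bar> powr p) = (\<Sum>c<m. \<bar>l c\<bar> powr p) * (\<Sum>c<n. \<bar>l' c\<bar> powr p)"
    by (simp add: sum_prod_index sum_product abs_mult powr_mult)
  then show ?thesis
    unfolding spectral_schatten[OF A] spectral_schatten[OF B] spectral_schatten[OF kron_spectral[OF A B]]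
    by (simp add: powr_mult sum_nonneg)
qed

lemma density_carrier: "density n A \<Longrightarrow> A \<in> carrier_mat n n"
  by (simp add: density_def psd_def)

text \<open>The projection onto the first basis vector is a state, which is where a positive
  dimension enters. The suprema in \<open>max_p_norm\<close> thus range over nonempty sets.\<close>

lemma density_exists:
  assumes "0 < n"
  shows "\<exists>\<rho>. density n \<rho>"
proof -
  define l where "l c = (if c = 0 then 1 else 0 :: real)" for c :: nat
  define u where "u c i = (if c = i then 1 else 0 :: complex)" for c i :: nat
  define \<rho> where "\<rho> = mat n n (\<lambda>(i, j). \<Sum>c<n. of_real (l c) * (u c i * cnj (u c j)))"
  have "cip n (u c) (u d) = (if c = d then 1 else 0)" if "c < n" "d < n" for c d
  proof -
    have "cip n (u c) (u d) = (\<Sum>i<n. if i = c then (if c = d then 1 else 0) else 0)"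
      unfolding cip_def u_def by (intro sum.cong) auto
    then show ?thesis using that by simp
  qed
  then have s: "spectral n \<rho> l u" by (simp add: spectral_def \<rho>_def orthonormal_def)
  have "(\<Sum>c<n. l c) = 1" using assms by (simp add: l_def)
  then have "mtrace \<rho> = 1" using spectral_trace[OF s] by simp
  moreover have "psd n \<rho>" by (rule spectral_psd[OF s]) (simp add: l_def)
  ultimately show ?thesis by (auto simp: density_def)
qed

lemma schatten_nonneg: "0 \<le> schatten p A"
  by (simp add: schatten_def Let_def)

text \<open>The eigenvalues lie between 0 and 1 and sum to 1, so raising them to the power
  \<open>p\<close> only decreases them. This bounds the suprema in
  \<open>max_p_norm\<close>.\<close>

lemma schatten_density_le_1:
  assumes "density n \<rho>" "1 \<le> p"
  shows "schatten p \<rho> \<le> 1"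
proof -
  obtain l u where l: "spectral n \<rho> l u" "\<And>c. c < n \<Longrightarrow> 0 \<le> l c"
    using psd_spectral assms(1) unfolding density_def by blast
  have "complex_of_real (\<Sum>c<n. l c) = 1"
    using assms(1) by (simp only: density_def spectral_trace[OF l(1)])
  then have 1: "(\<Sum>c<n. l c) = 1" using of_real_eq_1_iff by blast
  have "\<bar>l c\<bar> powr p \<le> l c" if c: "c < n" for c
  proof -
    have "l c \<le> (\<Sum>c<n. l c)" using c l(2) by (intro member_le_sum) auto
    then have "l c powr p \<le> l c powr 1" using 1 l(2)[OF c] assms(2) by (intro powr_mono') auto
    then show ?thesis using l(2)[OF c] by simp
  qed
  then have "(\<Sum>c<n. \<bar>l c\<bar> powr p) \<le> 1" using sum_mono[of "{..<n}" "\<lambda>c. \<bar>l c\<bar> powr p" l] 1 by simp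
  moreover have "0 \<le> (\<Sum>c<n. \<bar>l c\<bar> powr p)" by (intro sum_nonneg) auto
  ultimately show ?thesis unfolding spectral_schatten[OF l(1)]
    using assms(2) by (intro powr_le1) auto
qed

section \<open>Channels and maximal norms\<close>

text \<open>The common ground of both channels: sending states to states is what keeps
  \<open>max_p_norm\<close> finite.\<close>

definition density_map :: "nat \<Rightarrow> nat \<Rightarrow> (complex mat \<Rightarrow> complex mat) \<Rightarrow> bool" where
  "density_map n m \<Phi> \<longleftrightarrow> (\<forall>\<rho>. density n \<rho> \<longrightarrow> density m (\<Phi> \<rho>))"

lemma schatten_le_max_p_norm:
  assumes "density_map n m \<Phi>" "density n \<rho>" "1 \<le> p"
  shows "schatten p (\<Phi> \<rho>) \<le> max_p_norm p n \<Phi>"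
  unfolding max_p_norm_def
proof (rule cSUP_upper)
  show "bdd_above ((\<lambda>\<rho>. schatten p (\<Phi> \<rho>)) ` {\<rho>. density n \<rho>})"
    using assms(1,3) by (intro bdd_aboveI2[of _ _ 1]) (auto simp: density_map_def intro: schatten_density_le_1)
qed (use assms(2) in simp)

lemma max_p_norm_nonneg:
  assumes "density_map n m \<Phi>" "0 < n" "1 \<le> p"
  shows "0 \<le> max_p_norm p n \<Phi>"
proof -
  obtain \<rho> where "density n \<rho>" using density_exists[OF assms(2)] by blast
  then show ?thesis using schatten_le_max_p_norm[OF assms(1) _ assms(3)] schatten_nonneg order_trans by blast
qed

text \<open>\<open>linear_mmap\<close> provides binary sums only, so \<open>G\<close> is assembled
  entry by entry: \<open>P S\<close> keeps the entries of \<open>G\<close> at positions in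
  \<open>S\<close>, and the induction is on \<open>S\<close>.\<close>

lemma linear_mmap_expand:
  assumes lin: "linear_mmap n m \<Phi>" and G: "G \<in> carrier_mat n n" and b: "b < m" "b' < m"
  shows "\<Phi> G $$ (b, b') = (\<Sum>k<n. \<Sum>l<n. G $$ (k, l) * \<Phi> (munit n k l) $$ (b, b'))"
proof -
  define P where "P S = mat n n (\<lambda>ij. if ij \<in> S then G $$ ij else 0)" for S
  have c: "\<Phi> A \<in> carrier_mat m m" if "A \<in> carrier_mat n n" for A
    using lin that by (simp add: linear_mmap_def)
  have U: "munit n k l \<in> carrier_mat n n" for k l by (simp add: munit_def)
  have PC: "P S \<in> carrier_mat n n" for S by (simp add: P_def)
  have "\<Phi> (P S) $$ (b, b') = (\<Sum>(k, l)\<in>S. G $$ (k, l) * \<Phi> (munit n k l) $$ (b, b'))"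
    if "finite S" "S \<subseteq> {..<n} \<times> {..<n}" for S
    using that
  proof (induction S rule: finite_induct)
    case empty
    \<comment> \<open>Homogeneity with the scalar 0 shows that the zero matrix goes to zero.\<close>
    have "P {} = 0 \<cdot>\<^sub>m P {}" by (rule eq_matI) (auto simp: P_def)
    then have "\<Phi> (P {}) = 0 \<cdot>\<^sub>m \<Phi> (P {})" using lin PC unfolding linear_mmap_def by metis
    then have "\<Phi> (P {}) $$ (b, b') = (0 \<cdot>\<^sub>m \<Phi> (P {})) $$ (b, b')" by simp
    also have "\<dots> = 0" using c[OF PC[of "{}"]] b by simp
    finally show ?case by simp
  next
    case (insert x S)
    obtain k l where x: "x = (k, l)" by (cases x)
    have "P (insert x S) = P S + G $$ (k, l) \<cdot>\<^sub>m munit n k l"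
      using insert by (intro eq_matI) (auto simp: P_def munit_def x)
    then have "\<Phi> (P (insert x S)) = \<Phi> (P S) + G $$ (k, l) \<cdot>\<^sub>m \<Phi> (munit n k l)"
      using lin PC U unfolding linear_mmap_def by (metis smult_carrier_mat)
    then show ?case using insert b c[OF PC[of S]] c[OF U[of k l]] by (simp add: x)
  qed
  from this[of "{..<n} \<times> {..<n}"] have "\<Phi> (P ({..<n} \<times> {..<n})) $$ (b, b')
      = (\<Sum>k<n. \<Sum>l<n. G $$ (k, l) * \<Phi> (munit n k l) $$ (b, b'))"
    by (simp add: sum.cartesian_product)
  moreover have "P ({..<n} \<times> {..<n}) = G" using G by (intro eq_matI) (auto simp: P_def)
  ultimately show ?thesis by simp
qed

lemma linear_mmap_carrier: "linear_mmap n m \<Phi> \<Longrightarrow> A \<in> carrier_mat n n \<Longrightarrow> \<Phi> A \<in> carrier_mat m m"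
  by (simp add: linear_mmap_def)

lemma munit_carrier: "munit n i j \<in> carrier_mat n n"
  by (simp add: munit_def)

lemma tensor_map_index:
  assumes "linear_mmap n1 m1 \<Phi>" "linear_mmap n2 m2 \<Omega>" "a < m1" "a' < m1" "b < m2" "b' < m2"
  shows "tensor_map n1 m1 n2 m2 \<Phi> \<Omega> X $$ (a * m2 + b, a' * m2 + b') =
    (\<Sum>i<n1. \<Sum>j<n1. \<Sum>k<n2. \<Sum>l<n2. X $$ (i * n2 + k, j * n2 + l)
      * (\<Phi> (munit n1 i j) $$ (a, a') * \<Omega> (munit n2 k l) $$ (b, b')))"
  using assms(3-) by (simp add: tensor_map_def prod_index_less
      kron_index[OF linear_mmap_carrier[OF assms(1) munit_carrier] linear_mmap_carrier[OF assms(2) munit_carrier]])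

lemma tensor_map_carrier: "tensor_map n1 m1 n2 m2 \<Phi> \<Omega> X \<in> carrier_mat (m1 * m2) (m1 * m2)"
  by (simp add: tensor_map_def)

lemma eq_mat_prod_indexI:
  assumes "A \<in> carrier_mat (m * n) (m * n)" "B \<in> carrier_mat (m * n) (m * n)"
    and "\<And>a a' b b'. a < m \<Longrightarrow> a' < m \<Longrightarrow> b < n \<Longrightarrow> b' < n \<Longrightarrow>
      A $$ (a * n + b, a' * n + b') = B $$ (a * n + b, a' * n + b')"
  shows "A = B"
proof (rule eq_matI)
  fix x y assume "x < dim_row B" "y < dim_col B"
  then have xy: "x < m * n" "y < m * n" using assms(2) by auto
  show "A $$ (x, y) = B $$ (x, y)"
    using assms(3)[of "x div n" "y div n" "x mod n" "y mod n"] prod_index_div_mod[OF xy(1)] prod_index_div_mod[OF xy(2)]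
    by simp
qed (use assms in auto)

text \<open>On a product input the fourfold sum over matrix units factors into the two expansions of
  \<open>\<Phi> A\<close> and \<open>\<Omega> B\<close>.\<close>

lemma tensor_map_kron:
  assumes "linear_mmap n1 m1 \<Phi>" "linear_mmap n2 m2 \<Omega>" "A \<in> carrier_mat n1 n1" "B \<in> carrier_mat n2 n2"
  shows "tensor_map n1 m1 n2 m2 \<Phi> \<Omega> (kron A B) = kron (\<Phi> A) (\<Omega> B)"
proof (rule eq_mat_prod_indexI[OF tensor_map_carrier])
  show "kron (\<Phi> A) (\<Omega> B) \<in> carrier_mat (m1 * m2) (m1 * m2)"
    by (rule kron_carrier[OF linear_mmap_carrier[OF assms(1,3)] linear_mmap_carrier[OF assms(2,4)]])
  fix a a' b b' assume i: "a < m1" "a' < m1" "b < m2" "b' < m2"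
  have "tensor_map n1 m1 n2 m2 \<Phi> \<Omega> (kron A B) $$ (a * m2 + b, a' * m2 + b')
      = (\<Sum>i<n1. \<Sum>j<n1. \<Sum>k<n2. \<Sum>l<n2. (A $$ (i, j) * \<Phi> (munit n1 i j) $$ (a, a'))
          * (B $$ (k, l) * \<Omega> (munit n2 k l) $$ (b, b')))"
    unfolding tensor_map_index[OF assms(1,2) i]
    by (intro sum.cong refl) (simp add: kron_index[OF assms(3,4)] mult_ac)
  also have "\<dots> = \<Phi> A $$ (a, a') * \<Omega> B $$ (b, b')"
    unfolding linear_mmap_expand[OF assms(1,3) i(1,2)] linear_mmap_expand[OF assms(2,4) i(3,4)]
    by (simp only: sum_distrib_right) (simp only: sum_distrib_left)
  also have "\<dots> = kron (\<Phi> A) (\<Omega> B) $$ (a * m2 + b, a' * m2 + b')"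
    using i by (simp add: kron_index[OF linear_mmap_carrier[OF assms(1,3)] linear_mmap_carrier[OF assms(2,4)]])
  finally show "tensor_map n1 m1 n2 m2 \<Phi> \<Omega> (kron A B) $$ (a * m2 + b, a' * m2 + b')
      = kron (\<Phi> A) (\<Omega> B) $$ (a * m2 + b, a' * m2 + b')" .
qed

text \<open>Complete positivity with a one-dimensional ancilla is positivity, because tensoring with
  \<open>1 \<times> 1\<close> matrices changes nothing.\<close>

lemma channel_density_map:
  assumes "channel n m \<Omega>"
  shows "density_map n m \<Omega>"
  unfolding density_map_def
proof (intro allI impI)
  fix \<rho> assume \<rho>: "density n \<rho>"
  have lin: "linear_mmap n m \<Omega>" and cp: "completely_positive n m \<Omega>" and tp: "trace_preserving n \<Omega>"
    using assms by (auto simp: channel_def)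
  have c: "\<rho> \<in> carrier_mat n n" using \<rho> by (rule density_carrier)
  have id: "linear_mmap 1 1 (\<lambda>A. A)" by (simp add: linear_mmap_def)
  have "tensor_map 1 1 n m (\<lambda>A. A) \<Omega> \<rho> = \<Omega> \<rho>"
  proof (rule eq_mat_prod_indexI[OF tensor_map_carrier])
    show "\<Omega> \<rho> \<in> carrier_mat (1 * m) (1 * m)" using linear_mmap_carrier[OF lin c] by simp
    fix a a' b b' assume i: "a < (1::nat)" "a' < (1::nat)" "b < m" "b' < m"
    show "tensor_map 1 1 n m (\<lambda>A. A) \<Omega> \<rho> $$ (a * m + b, a' * m + b') = \<Omega> \<rho> $$ (a * m + b, a' * m + b')"
      unfolding tensor_map_index[OF id lin i] using i
      by (simp add: linear_mmap_expand[OF lin c i(3,4)] munit_def)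
  qed
  then have "psd m (\<Omega> \<rho>)"
    using cp \<rho> unfolding completely_positive_def density_def by (metis mult_1)
  moreover have "mtrace (\<Omega> \<rho>) = 1" using tp c \<rho> by (simp add: trace_preserving_def density_def)
  ultimately show "density m (\<Omega> \<rho>)" by (simp add: density_def)
qed

section \<open>Schatten norms of separable matrices\<close>

lemma hermitian_matD:
  "hermitian_mat n A \<Longrightarrow> i < n \<Longrightarrow> j < n \<Longrightarrow> cnj (A $$ (i, j)) = A $$ (j, i)"
  unfolding hermitian_mat_def by metis

lemma parseval:
  assumes "orthonormal n b"
  shows "(\<Sum>a<n. cnj (cip n (b a) f) * cip n (b a) g) = cip n f g"
proof -
  have "cip n f g = cip n f (\<lambda>i. \<Sum>a<n. cip n (b a) g * b a i)"
    by (rule cip_cong) (auto intro: orthonormal_expand[OF assms])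
  also have "\<dots> = (\<Sum>a<n. cip n (b a) g * cnj (cip n (b a) f))"
    unfolding cip_sum_right by (intro sum.cong refl) (subst cip_commute, simp)
  finally show ?thesis by (simp add: mult.commute)
qed

lemma bform_sum:
  "bform n (mat n n (\<lambda>ij. \<Sum>k<K. R k $$ ij)) f g = (\<Sum>k<(K::nat). bform n (R k) f g)"
  unfolding bform_def by (simp add: sum_distrib_left) (rule sum_rotate)

lemma psd_sum:
  assumes "\<And>k. k < K \<Longrightarrow> psd n (R k)"
  shows "psd n (mat n n (\<lambda>ij. \<Sum>k<(K::nat). R k $$ ij))"
  unfolding psd_iff bform_sum
proof (intro conjI allI)
  have h: "R k $$ (j, i) = cnj (R k $$ (i, j))" if "k < K" "i < n" "j < n" for k i j
    using psd_hermitian[OF assms[OF that(1)]] that unfolding hermitian_mat_def by blast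
  then have "(\<Sum>k<K. R k $$ (j, i)) = cnj (\<Sum>k<K. R k $$ (i, j))" if "i < n" "j < n" for i j
    unfolding cnj_sum using that by (intro sum.cong refl) blast
  then show "hermitian_mat n (mat n n (\<lambda>ij. \<Sum>k<K. R k $$ ij))"
    by (simp add: hermitian_mat_def)
  fix f
  show "Im (\<Sum>k<K. qform n (R k) f) = 0"
    using assms by (simp add: psd_iff)
  show "0 \<le> Re (\<Sum>k<K. qform n (R k) f)"
    unfolding Re_sum using assms by (intro sum_nonneg) (simp add: psd_iff)
qed

lemma psd_smult:
  assumes "psd n A" "0 \<le> x"
  shows "psd n (complex_of_real x \<cdot>\<^sub>m A)"
proof -
  have A: "A \<in> carrier_mat n n" using assms(1) by (rule psd_carrier)
  then have "bform n (complex_of_real x \<cdot>\<^sub>m A) f f = of_real x * bform n A f f" for f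
    by (simp add: bform_def sum_distrib_left mult_ac)
  moreover have "hermitian_mat n (complex_of_real x \<cdot>\<^sub>m A)"
  proof -
    have "cnj (A $$ (i, j)) = A $$ (j, i)" if "i < n" "j < n" for i j
      by (rule hermitian_matD[OF psd_hermitian[OF assms(1)] that])
    then show ?thesis using A by (simp add: hermitian_mat_def)
  qed
  ultimately show ?thesis using assms by (simp add: psd_iff)
qed

text \<open>Splitting each \<open>R k\<close> into rank-one parts indexed by \<open>r\<close> makes
  this an instance of \<open>product_overlap\<close> with index set of pairs \<open>(k, r)\<close>;
  the eigenvectors of \<open>M\<close> serve as the \<open>g c\<close>.\<close>

theorem schatten_separable_le:
  assumes R: "\<And>k. k < K \<Longrightarrow> psd m (R k)" and W: "\<And>k. k < K \<Longrightarrow> psd n (W k)"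
    and v: "\<And>k. k < K \<Longrightarrow> schatten p (W k) \<le> v" and v0: "0 \<le> v" and p: "1 \<le> p"
  defines "S \<equiv> mat m m (\<lambda>ij. \<Sum>k<(K::nat). R k $$ ij)"
    and "M \<equiv> mat (m * n) (m * n) (\<lambda>ij. \<Sum>k<K. kron (R k) (W k) $$ ij)"
  shows "schatten p M \<le> schatten p S * v"
proof -
  have "\<forall>k. \<exists>l u. k < K \<longrightarrow> spectral m (R k) l u \<and> (\<forall>c<m. 0 \<le> l c)" using psd_spectral R by blast
  then obtain lr ur where r: "\<And>k. k < K \<Longrightarrow> spectral m (R k) (lr k) (ur k)"
    and lr: "\<And>k c. k < K \<Longrightarrow> c < m \<Longrightarrow> 0 \<le> lr k c" by metis
  have "\<forall>k. \<exists>l u. k < K \<longrightarrow> spectral n (W k) l u \<and> (\<forall>c<n. 0 \<le> l c)" using psd_spectral W by blast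
  then obtain lw uw where w: "\<And>k. k < K \<Longrightarrow> spectral n (W k) (lw k) (uw k)"
    and lw: "\<And>k c. k < K \<Longrightarrow> c < n \<Longrightarrow> 0 \<le> lw k c" by metis
  obtain s b where S: "spectral m S s b" and s: "\<And>c. c < m \<Longrightarrow> 0 \<le> s c"
    using psd_spectral[OF psd_sum[of K m R]] R unfolding S_def by blast
  have "psd (m * n) M" unfolding M_def by (intro psd_sum kron_psd R W)
  then obtain l h where M: "spectral (m * n) M l h" and l: "\<And>c. c < m * n \<Longrightarrow> 0 \<le> l c"
    using psd_spectral by blast
  have b: "orthonormal m b" using S by (simp add: spectral_def)
  \<comment> \<open>The eigenvectors of \<open>R k\<close>, scaled by the square roots of their
    eigenvalues and written in the eigenbasis \<open>b\<close> of \<open>S\<close>.\<close>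
  define \<psi> where "\<psi> = (\<lambda>(k, r) a. of_real (sqrt (lr k r)) * cip m (b a) (ur k r))"
  \<comment> \<open>Only the first tensor factor of \<open>h c\<close> is passed to the basis
    \<open>b\<close>; the second keeps its standard coordinate \<open>y\<close>.\<close>
  define g where "g c = (\<lambda>(a, y). cip m (b a) (\<lambda>i. h c (i * n + y)))" for c
  interpret product_overlap "{..<m}" "{..<K} \<times> {..<m}" "{..<n}" "{..<n}" "{..<m * n}"
    s \<psi> "\<lambda>(k, r). lw k" "\<lambda>(k, r). uw k" g
  proof
    fix a a' assume a: "a \<in> {..<m}" "a' \<in> {..<m}"
    \<comment> \<open>The sum is the matrix entry of \<open>S\<close> in the basis \<open>b\<close>,
      where \<open>S\<close> is diagonal.\<close>
    have "(\<Sum>k\<in>{..<K} \<times> {..<m}. \<psi> k a * cnj (\<psi> k a'))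
        = (\<Sum>k<K. \<Sum>r<m. of_real (lr k r) * (cip m (b a) (ur k r) * cip m (ur k r) (b a')))"
      unfolding sum.cartesian_product'
    proof (intro sum.cong refl)
      fix k r assume "k \<in> {..<K}" "r \<in> {..<m}"
      then have "complex_of_real (sqrt (lr k r)) * of_real (sqrt (lr k r)) = of_real (lr k r)"
        using lr by (simp flip: of_real_mult)
      then show "\<psi> (k, r) a * cnj (\<psi> (k, r) a')
          = of_real (lr k r) * (cip m (b a) (ur k r) * cip m (ur k r) (b a'))"
        by (simp add: \<psi>_def cip_commute[of m "ur k r" "b a'"] mult_ac)
    qed
    also have "\<dots> = bform m S (b a) (b a')"
      unfolding S_def bform_sum by (intro sum.cong refl) (simp add: spectral_bform[OF r])
    also have "\<dots> = (\<Sum>c<m. if c = a then (if a = a' then of_real (s a) else 0) else 0)"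
      unfolding spectral_bform[OF S] using b a by (intro sum.cong refl) (auto simp: orthonormal_def)
    also have "\<dots> = (if a = a' then of_real (s a) else 0)" using a by simp
    finally show "(\<Sum>k\<in>{..<K} \<times> {..<m}. \<psi> k a * cnj (\<psi> k a')) = (if a = a' then of_real (s a) else 0)" .
  next
    fix c d assume "c \<in> {..<m * n}" "d \<in> {..<m * n}"
    then have cd: "cip (m * n) (h c) (h d) = (if c = d then 1 else 0)"
      using M by (simp add: spectral_def orthonormal_def)
    \<comment> \<open>The change to the orthonormal basis \<open>b\<close> preserves inner products,
      slice by slice in \<open>y\<close>.\<close>
    have "(\<Sum>x\<in>{..<m} \<times> {..<n}. cnj (g c x) * g d x)
        = (\<Sum>y<n. cip m (\<lambda>i. h c (i * n + y)) (\<lambda>i. h d (i * n + y)))"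
      unfolding sum.cartesian_product' g_def prod.case by (subst sum.swap) (simp add: parseval[OF b])
    also have "\<dots> = cip (m * n) (h c) (h d)"
      unfolding cip_def sum_prod_index by (rule sum.swap)
    finally show "(\<Sum>x\<in>{..<m} \<times> {..<n}. cnj (g c x) * g d x) = (if c = d then 1 else 0)"
      using cd by simp
  next
    fix k i j assume "k \<in> {..<K} \<times> {..<m}" "i \<in> {..<n}" "j \<in> {..<n}"
    then show "(\<Sum>y<n. cnj ((case k of (k, r) \<Rightarrow> uw k) i y) * (case k of (k, r) \<Rightarrow> uw k) j y) = (if i = j then 1 else 0)"
      using w by (auto simp: spectral_def orthonormal_def cip_def)
  qed (use s lw in auto)
  \<comment> \<open>\<open>\<mu> c\<close> is the quadratic form of \<open>M\<close> at its own unit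
    eigenvector \<open>h c\<close>, hence the eigenvalue.\<close>
  have \<mu>: "\<mu> c = l c" if c: "c < m * n" for c
  proof -
    define z where "z k r j x = ur k r (x div n) * uw k j (x mod n)" for k r j x
    have "(\<Sum>(a, y)\<in>{..<m} \<times> {..<n}. cnj (g c (a, y)) * (\<psi> (k, r) a * uw k j y))
        = of_real (sqrt (lr k r)) * cip (m * n) (h c) (z k r j)" for k r j
    proof -
      have "(\<Sum>(a, y)\<in>{..<m} \<times> {..<n}. cnj (g c (a, y)) * (\<psi> (k, r) a * uw k j y))
          = (\<Sum>y<n. of_real (sqrt (lr k r)) * uw k j y
              * (\<Sum>a<m. cnj (cip m (b a) (\<lambda>i. h c (i * n + y))) * cip m (b a) (ur k r)))"
        unfolding sum.cartesian_product[symmetric] g_def \<psi>_def prod.case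
        by (subst sum.swap) (simp add: sum_distrib_left mult_ac)
      also have "\<dots> = (\<Sum>y<n. \<Sum>i<m. of_real (sqrt (lr k r)) * (cnj (h c (i * n + y)) * z k r j (i * n + y)))"
        unfolding parseval[OF b] by (simp add: cip_def z_def sum_distrib_left mult_ac)
      also have "\<dots> = of_real (sqrt (lr k r)) * cip (m * n) (h c) (z k r j)"
        unfolding cip_def sum_prod_index sum_distrib_left by (rule sum.swap)
      finally show ?thesis .
    qed
    then have "\<mu> c = (\<Sum>k<K. \<Sum>r<m. \<Sum>j<n. lw k j * ((sqrt (lr k r))\<^sup>2 * (cmod (cip (m * n) (h c) (z k r j)))\<^sup>2))"
      unfolding \<mu>_def sum.cartesian_product' prod.case
      by (simp add: norm_mult power_mult_distrib)
    also have "\<dots> = (\<Sum>k<K. \<Sum>r<m. \<Sum>j<n. lr k r * lw k j * (cmod (cip (m * n) (z k r j) (h c)))\<^sup>2)"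
      using lr by (intro sum.cong refl) (simp add: cip_commute[of _ "h c"] mult_ac)
    finally have "complex_of_real (\<mu> c) = of_real (\<Sum>k<K. \<Sum>r<m. \<Sum>j<n.
        lr k r * lw k j * (cmod (cip (m * n) (z k r j) (h c)))\<^sup>2)" by (rule arg_cong)
    also have "\<dots> = (\<Sum>k<K. qform (m * n) (kron (R k) (W k)) (h c))"
      unfolding of_real_sum[of _ "{..<K}"]
      by (intro sum.cong refl) (simp add: spectral_qform[OF kron_spectral[OF r w]] sum_prod_index z_def[abs_def])
    also have "\<dots> = of_real (l c)"
      using spectral_qform_eigenvector[OF M c] by (simp only: M_def bform_sum)
    finally show ?thesis by (simp only: of_real_eq_iff)
  qed
  \<comment> \<open>The norm bound raised to the power \<open>p\<close>, so that
    \<open>V = v powr p\<close> in the interpolation estimate.\<close>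
  have "(\<Sum>j<n. lw k j powr p) \<le> v powr p" if k: "k < K" for k
  proof -
    have "(\<Sum>j<n. lw k j powr p) = (\<Sum>j<n. \<bar>lw k j\<bar> powr p)" using lw[OF k] by (intro sum.cong) auto
    also have "\<dots> = schatten p (W k) powr p"
      unfolding spectral_schatten[OF w[OF k]] using p by (simp add: powr_powr sum_nonneg)
    also have "\<dots> \<le> v powr p" using v[OF k] p by (intro powr_mono2 schatten_nonneg) auto
    finally show ?thesis .
  qed
  then have "(\<Sum>c<m * n. \<mu> c powr p) \<le> v powr p * (\<Sum>a<m. s a powr p)"
    by (intro sum_powr_overlap_le p) auto
  moreover have "(\<Sum>c<m * n. \<mu> c powr p) = (\<Sum>c<m * n. \<bar>l c\<bar> powr p)"
    using \<mu> l by (intro sum.cong) auto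
  moreover have "(\<Sum>a<m. s a powr p) = (\<Sum>a<m. \<bar>s a\<bar> powr p)" using s by (intro sum.cong) auto
  ultimately have "schatten p M \<le> (v powr p * (\<Sum>a<m. \<bar>s a\<bar> powr p)) powr (1 / p)"
    unfolding spectral_schatten[OF M] using p by (intro powr_mono2 sum_nonneg) auto
  also have "\<dots> = schatten p S * v"
    unfolding spectral_schatten[OF S] using v0 p by (simp add: powr_mult powr_powr sum_nonneg)
  finally show ?thesis .
qed

section \<open>Partial traces and conditional states\<close>

lemma mtrace_mult:
  assumes "A \<in> carrier_mat n n" "B \<in> carrier_mat n n"
  shows "mtrace (A * B) = (\<Sum>i<n. \<Sum>j<n. A $$ (i, j) * B $$ (j, i))"
  using assms by (simp add: mtrace_def scalar_prod_def lessThan_atLeast0)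

text \<open>Expanding \<open>A\<close> in eigenvectors writes the trace as a nonnegative combination
  of quadratic forms of \<open>B\<close>. It yields the outcome probabilities of the
  measurement.\<close>

lemma psd_mtrace_mult:
  assumes "psd n A" "psd n B"
  shows "\<exists>x\<ge>0. mtrace (A * B) = of_real x"
proof -
  obtain l u where A: "spectral n A l u" "\<And>c. c < n \<Longrightarrow> 0 \<le> l c" using psd_spectral assms(1) by blast
  obtain l' u' where B: "spectral n B l' u'" "\<And>c. c < n \<Longrightarrow> 0 \<le> l' c" using psd_spectral assms(2) by blast
  have "mtrace (A * B) = (\<Sum>j<n. \<Sum>i<n. A $$ (i, j) * B $$ (j, i))"
    using assms by (subst sum.swap) (simp add: mtrace_mult psd_carrier)
  also have "\<dots> = (\<Sum>j<n. \<Sum>i<n. \<Sum>c<n. of_real (l c) * (cnj (u c j) * u c i * B $$ (j, i)))"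
    using A(1) by (intro sum.cong refl) (simp add: spectral_def sum_distrib_left sum_distrib_right mult_ac)
  also have "\<dots> = (\<Sum>c<n. of_real (l c) * qform n B (u c))"
    unfolding bform_def sum_distrib_left by (rule sum_rotate)
  also have "\<dots> = of_real (\<Sum>c<n. l c * (\<Sum>d<n. l' d * (cmod (cip n (u' d) (u c)))\<^sup>2))"
    unfolding spectral_qform[OF B(1)] by (simp del: of_real_power)
  finally show ?thesis using A(2) B(2)
    by (intro exI[of _ "\<Sum>c<n. l c * (\<Sum>d<n. l' d * (cmod (cip n (u' d) (u c)))\<^sup>2)"])
       (auto intro!: sum_nonneg mult_nonneg_nonneg)
qed

lemma psd_normalize:
  assumes "psd n G" "0 < n" "mtrace G = of_real x"
  shows "\<exists>\<tau>. density n \<tau> \<and> G = of_real x \<cdot>\<^sub>m \<tau>"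
proof -
  obtain l u where G: "spectral n G l u" and l: "\<And>c. c < n \<Longrightarrow> 0 \<le> l c" using psd_spectral assms(1) by blast
  have x: "x = (\<Sum>c<n. l c)" using assms(3) spectral_trace[OF G] of_real_eq_iff by metis
  have c: "G \<in> carrier_mat n n" using assms(1) by (rule psd_carrier)
  show ?thesis
  proof (cases "x = 0")
    case True
    then have "l c = 0" if "c < n" for c
      using that x l True sum_nonneg_0[of "{..<n}" l c] by auto
    \<comment> \<open>With trace 0 there is no normalisation, but all eigenvalues vanish, so
      \<open>G\<close> is zero and an arbitrary state serves.\<close>
    moreover obtain \<tau> where \<tau>: "density n \<tau>" using density_exists[OF assms(2)] by blast
    ultimately have "G = of_real x \<cdot>\<^sub>m \<tau>"
      using G c density_carrier[OF \<tau>] True by (intro eq_matI) (auto simp: spectral_def)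
    then show ?thesis using \<tau> by blast
  next
    case False
    then have x0: "0 < x" using x l by (metis lessThan_iff less_eq_real_def sum_nonneg)
    define \<tau> where "\<tau> = of_real (1 / x) \<cdot>\<^sub>m G"
    have "psd n \<tau>" unfolding \<tau>_def using x0 by (intro psd_smult assms(1)) simp
    moreover have "mtrace \<tau> = of_real (1 / x) * mtrace G"
      using c by (simp add: mtrace_def \<tau>_def sum_distrib_left)
    then have "mtrace \<tau> = 1" using x0 by (simp add: assms(3))
    moreover have "G = of_real x \<cdot>\<^sub>m \<tau>"
      using c x0 by (intro eq_matI) (auto simp: \<tau>_def)
    ultimately show ?thesis by (auto simp: density_def)
  qed
qed

text \<open>\<open>Tr\<^sub>1 ((X \<otimes> 1) \<rho>)\<close>\<close>

definition slice_trace :: "nat \<Rightarrow> nat \<Rightarrow> complex mat \<Rightarrow> complex mat \<Rightarrow> complex mat" where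
  "slice_trace n1 n2 X \<rho> = mat n2 n2 (\<lambda>(y, y').
     \<Sum>i<n1. \<Sum>j<n1. X $$ (j, i) * \<rho> $$ (i * n2 + y, j * n2 + y'))"

definition ptrace :: "nat \<Rightarrow> nat \<Rightarrow> complex mat \<Rightarrow> complex mat" where
  "ptrace n1 n2 \<rho> = mat n1 n1 (\<lambda>(i, j). \<Sum>y<n2. \<rho> $$ (i * n2 + y, j * n2 + y))"

text \<open>Expanding \<open>X\<close> in eigenvectors, the form at \<open>f\<close> is a
  nonnegative combination of the forms of \<open>\<rho>\<close> at the product vectors of
  \<open>u c\<close> with \<open>f\<close>.\<close>

lemma slice_trace_psd:
  assumes X: "psd n1 X" and \<rho>: "psd (n1 * n2) \<rho>"
  shows "psd n2 (slice_trace n1 n2 X \<rho>)"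
proof -
  let ?G = "slice_trace n1 n2 X \<rho>"
  obtain l u where u: "spectral n1 X l u" "\<And>c. c < n1 \<Longrightarrow> 0 \<le> l c" using psd_spectral X by blast
  have "?G $$ (y', y) = cnj (?G $$ (y, y'))" if "y < n2" "y' < n2" for y y'
  proof -
    have "cnj (?G $$ (y, y')) = (\<Sum>i<n1. \<Sum>j<n1. X $$ (i, j) * \<rho> $$ (j * n2 + y', i * n2 + y))"
      using that by (simp add: slice_trace_def prod_index_less hermitian_matD[OF psd_hermitian[OF X]]
          hermitian_matD[OF psd_hermitian[OF \<rho>]])
    also have "\<dots> = ?G $$ (y', y)"
      using that by (subst sum.swap) (simp add: slice_trace_def)
    finally show ?thesis by simp
  qed
  then have herm: "hermitian_mat n2 ?G" by (simp add: hermitian_mat_def slice_trace_def)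
  have "qform n2 ?G f = (\<Sum>c<n1. of_real (l c) * qform (n1 * n2) \<rho> (\<lambda>z. u c (z div n2) * f (z mod n2)))" for f
  proof -
    define T where "T i j = (\<Sum>y<n2. \<Sum>y'<n2. cnj (f y) * f y' * \<rho> $$ (i * n2 + y, j * n2 + y'))" for i j
    have q: "(\<Sum>i<n1. \<Sum>j<n1. cnj (u c i) * u c j * T i j)
        = qform (n1 * n2) \<rho> (\<lambda>z. u c (z div n2) * f (z mod n2))" for c
      unfolding bform_def sum_prod_index T_def sum_distrib_left
      by (rule sum.cong[OF refl], subst (2) sum.swap) (simp add: mult_ac)
    have "qform n2 ?G f = (\<Sum>y<n2. \<Sum>y'<n2. \<Sum>i<n1. \<Sum>j<n1.
        X $$ (j, i) * (cnj (f y) * f y' * \<rho> $$ (i * n2 + y, j * n2 + y')))"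
      by (simp add: bform_def slice_trace_def sum_distrib_left mult_ac)
    also have "\<dots> = (\<Sum>i<n1. \<Sum>j<n1. X $$ (j, i) * T i j)"
      unfolding T_def sum_distrib_left
      by (subst sum_rotate) (intro sum.cong refl sum_rotate)
    also have "\<dots> = (\<Sum>i<n1. \<Sum>j<n1. \<Sum>c<n1. of_real (l c) * (cnj (u c i) * u c j * T i j))"
      using u(1) by (intro sum.cong refl) (simp add: spectral_def sum_distrib_left sum_distrib_right mult_ac)
    also have "\<dots> = (\<Sum>c<n1. of_real (l c) * (\<Sum>i<n1. \<Sum>j<n1. cnj (u c i) * u c j * T i j))"
      unfolding sum_distrib_left by (rule sum_rotate)
    finally show ?thesis by (simp only: q)
  qed
  then show ?thesis using \<rho> u(2) herm
    by (auto simp: psd_iff intro!: sum_nonneg)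
qed

text \<open>The form at \<open>f\<close> is the sum over \<open>y\<close> of the form of
  \<open>\<rho>\<close> at the product of \<open>f\<close> with the standard basis vector
  \<open>y\<close>.\<close>

lemma ptrace_density:
  assumes \<rho>: "density (n1 * n2) \<rho>"
  shows "density n1 (ptrace n1 n2 \<rho>)"
proof -
  let ?r = "ptrace n1 n2 \<rho>"
  have p: "psd (n1 * n2) \<rho>" using \<rho> by (simp add: density_def)
  have c: "\<rho> \<in> carrier_mat (n1 * n2) (n1 * n2)" using p by (rule psd_carrier)
  have "cnj (?r $$ (i, j)) = ?r $$ (j, i)" if "i < n1" "j < n1" for i j
    using that by (simp add: ptrace_def prod_index_less hermitian_matD[OF psd_hermitian[OF p]])
  then have herm: "hermitian_mat n1 ?r" by (simp add: hermitian_mat_def) (simp add: ptrace_def)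
  have "qform n1 ?r f = (\<Sum>y<n2. qform (n1 * n2) \<rho> (\<lambda>z. f (z div n2) * (if z mod n2 = y then 1 else 0)))" for f
  proof -
    have "qform (n1 * n2) \<rho> (\<lambda>z. f (z div n2) * (if z mod n2 = y then 1 else 0))
        = (\<Sum>i<n1. \<Sum>j<n1. cnj (f i) * f j * \<rho> $$ (i * n2 + y, j * n2 + y))" if "y < n2" for y
    proof -
      have "qform (n1 * n2) \<rho> (\<lambda>z. f (z div n2) * (if z mod n2 = y then 1 else 0))
          = (\<Sum>i<n1. \<Sum>y1<n2. \<Sum>j<n1. \<Sum>y2<n2. if y2 = y then
              (if y1 = y then cnj (f i) * f j * \<rho> $$ (i * n2 + y, j * n2 + y) else 0) else 0)"
        unfolding bform_def sum_prod_index by (intro sum.cong refl) auto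
      also have "\<dots> = (\<Sum>i<n1. \<Sum>j<n1. \<Sum>y1<n2. if y1 = y then cnj (f i) * f j * \<rho> $$ (i * n2 + y, j * n2 + y) else 0)"
        by (rule sum.cong[OF refl], subst sum.swap) (simp add: that)
      finally show ?thesis using that by simp
    qed
    moreover have "qform n1 ?r f = (\<Sum>y<n2. \<Sum>i<n1. \<Sum>j<n1. cnj (f i) * f j * \<rho> $$ (i * n2 + y, j * n2 + y))"
      by (subst sum_rotate[symmetric]) (simp add: bform_def ptrace_def sum_distrib_left)
    ultimately show ?thesis by simp
  qed
  then have "psd n1 ?r" using p herm unfolding psd_iff by (simp add: sum_nonneg)
  moreover have "mtrace ?r = mtrace \<rho>"
    using c by (simp add: mtrace_def ptrace_def sum_prod_index)
  ultimately show ?thesis using \<rho> by (simp add: density_def)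
qed

text \<open>The trace of the conditional operator depends on the first marginal alone. This matches
  the weights in the joint output with those in the output of \<open>\<Phi>\<close> on the
  marginal.\<close>

lemma slice_trace_mtrace:
  assumes X: "X \<in> carrier_mat n1 n1"
  shows "mtrace (slice_trace n1 n2 X \<rho>) = mtrace (X * ptrace n1 n2 \<rho>)"
proof -
  have "mtrace (X * ptrace n1 n2 \<rho>) = (\<Sum>i<n1. \<Sum>j<n1. \<Sum>y<n2. X $$ (j, i) * \<rho> $$ (i * n2 + y, j * n2 + y))"
    by (subst mtrace_mult[OF X], simp add: ptrace_def, subst sum.swap) (simp add: ptrace_def sum_distrib_left)
  also have "\<dots> = mtrace (slice_trace n1 n2 X \<rho>)"
    by (subst sum_rotate) (simp add: mtrace_def slice_trace_def)
  finally show ?thesis by simp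
qed

section \<open>Entanglement breaking maps and multiplicativity\<close>

locale eb_map =
  fixes n m :: nat and \<Phi> :: "complex mat \<Rightarrow> complex mat" and K :: nat
    and R X :: "nat \<Rightarrow> complex mat"
  assumes R: "\<And>k. k < K \<Longrightarrow> density m (R k)" and X: "\<And>k. k < K \<Longrightarrow> psd n (X k)"
    and povm: "mat n n (\<lambda>(a, b). \<Sum>k<K. X k $$ (a, b)) = 1\<^sub>m n"
    and \<Phi>: "\<And>\<rho>. \<rho> \<in> carrier_mat n n \<Longrightarrow>
      \<Phi> \<rho> = mat m m (\<lambda>(a, b). \<Sum>k<K. R k $$ (a, b) * mtrace (X k * \<rho>))"
begin

lemma mtrace_X:
  "k < K \<Longrightarrow> A \<in> carrier_mat n n \<Longrightarrow> mtrace (X k * A) = (\<Sum>i<n. \<Sum>j<n. X k $$ (i, j) * A $$ (j, i))"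
  by (rule mtrace_mult[OF psd_carrier[OF X]])

lemma linear: "linear_mmap n m \<Phi>"
  unfolding linear_mmap_def
proof (intro conjI ballI allI)
  fix A B :: "complex mat" and c assume A: "A \<in> carrier_mat n n"
  show "\<Phi> A \<in> carrier_mat m m" using A by (simp add: \<Phi>)
  show "\<Phi> (c \<cdot>\<^sub>m A) = c \<cdot>\<^sub>m \<Phi> A"
    using A by (intro eq_matI) (auto simp: \<Phi> mtrace_X sum_distrib_left mult_ac)
  assume B: "B \<in> carrier_mat n n"
  show "\<Phi> (A + B) = \<Phi> A + \<Phi> B"
    using A B by (intro eq_matI) (auto simp: \<Phi> mtrace_X sum.distrib distrib_left)
qed

lemma \<Phi>_munit:
  assumes "i < n" "j < n" "a < m" "b < m"
  shows "\<Phi> (munit n i j) $$ (a, b) = (\<Sum>k<K. R k $$ (a, b) * X k $$ (j, i))"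
proof -
  have "mtrace (X k * munit n i j) = X k $$ (j, i)" if "k < K" for k
  proof -
    have "mtrace (X k * munit n i j) = (\<Sum>i'<n. \<Sum>j'<n. if j' = i then (if i' = j then X k $$ (j, i) else 0) else 0)"
      unfolding mtrace_X[OF that munit_carrier] by (intro sum.cong refl) (simp add: munit_def)
    then show ?thesis using assms by simp
  qed
  then show ?thesis using assms by (simp add: \<Phi> munit_carrier)
qed

text \<open>The output is a convex combination of the \<open>R k\<close>: the weights are
  nonnegative by \<open>psd_mtrace_mult\<close> and sum to the trace of \<open>\<rho>\<close> by
  \<open>povm\<close>.\<close>

lemma density_map: "density_map n m \<Phi>"
  unfolding density_map_def
proof (intro allI impI)
  fix \<rho> assume \<rho>: "density n \<rho>"
  have c: "\<rho> \<in> carrier_mat n n" using \<rho> by (rule density_carrier)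
  have "\<forall>k. \<exists>x. k < K \<longrightarrow> 0 \<le> x \<and> mtrace (X k * \<rho>) = of_real x"
    using psd_mtrace_mult X \<rho> unfolding density_def by meson
  then obtain x where x: "\<And>k. k < K \<Longrightarrow> 0 \<le> x k" "\<And>k. k < K \<Longrightarrow> mtrace (X k * \<rho>) = of_real (x k)"
    by metis
  have RC: "R k \<in> carrier_mat m m" if "k < K" for k using R[OF that] by (rule density_carrier)
  have "\<Phi> \<rho> = mat m m (\<lambda>ij. \<Sum>k<K. (of_real (x k) \<cdot>\<^sub>m R k) $$ ij)"
    unfolding \<Phi>[OF c] by (intro eq_matI) (auto simp: x(2) carrier_matD[OF RC] mult.commute intro!: sum.cong)
  moreover have "psd m \<dots>"
    using R x(1) by (intro psd_sum psd_smult) (auto simp: density_def)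
  moreover have "mtrace (\<Phi> \<rho>) = 1"
  proof -
    have "mtrace (\<Phi> \<rho>) = (\<Sum>k<K. (\<Sum>a<m. R k $$ (a, a)) * mtrace (X k * \<rho>))"
      unfolding \<Phi>[OF c] mtrace_def[of "mat m m _"]
      by (simp add: sum_distrib_right) (rule sum.swap)
    also have "\<dots> = (\<Sum>k<K. mtrace (X k * \<rho>))"
    proof (intro sum.cong refl)
      fix k assume "k \<in> {..<K}"
      then have "(\<Sum>a<m. R k $$ (a, a)) = 1" using R[of k] RC[of k] by (simp add: density_def mtrace_def)
      then show "(\<Sum>a<m. R k $$ (a, a)) * mtrace (X k * \<rho>) = mtrace (X k * \<rho>)" by simp
    qed
    also have "\<dots> = (\<Sum>k<K. \<Sum>i<n. \<Sum>j<n. X k $$ (i, j) * \<rho> $$ (j, i))"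
      by (intro sum.cong refl) (simp add: mtrace_X c)
    also have "\<dots> = (\<Sum>i<n. \<Sum>j<n. (\<Sum>k<K. X k $$ (i, j)) * \<rho> $$ (j, i))"
      unfolding sum_distrib_right by (rule sum_rotate[symmetric])
    also have "\<dots> = (\<Sum>i<n. \<Sum>j<n. if i = j then \<rho> $$ (j, i) else 0)"
    proof (intro sum.cong refl)
      fix i j assume "i \<in> {..<n}" "j \<in> {..<n}"
      then have "(\<Sum>k<K. X k $$ (i, j)) = (if i = j then 1 else 0)"
        using arg_cong[OF povm, of "\<lambda>M. M $$ (i, j)"] by simp
      then show "(\<Sum>k<K. X k $$ (i, j)) * \<rho> $$ (j, i) = (if i = j then \<rho> $$ (j, i) else 0)" by simp
    qed
    also have "\<dots> = mtrace \<rho>" using c by (simp add: mtrace_def)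
    finally show ?thesis using \<rho> by (simp add: density_def)
  qed
  ultimately show "density m (\<Phi> \<rho>)" by (simp add: density_def)
qed

text \<open>Summing over the matrix units of the first factor contracts \<open>\<rho>\<close> with
  \<open>X k\<close> before \<open>\<Omega>\<close> acts. Whatever entanglement the input has, the
  output is a sum of products.\<close>

lemma tensor_map_eq:
  assumes \<Omega>: "linear_mmap n2 m2 \<Omega>"
  shows "tensor_map n m n2 m2 \<Phi> \<Omega> \<rho>
    = mat (m * m2) (m * m2) (\<lambda>ij. \<Sum>k<K. kron (R k) (\<Omega> (slice_trace n n2 (X k) \<rho>)) $$ ij)"
proof (rule eq_mat_prod_indexI[OF tensor_map_carrier])
  fix a a' b b' assume i: "a < m" "a' < m" "b < m2" "b' < m2"
  have G: "slice_trace n n2 (X k) \<rho> \<in> carrier_mat n2 n2" for k by (simp add: slice_trace_def)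
  define U where "U y y' = \<Omega> (munit n2 y y') $$ (b, b')" for y y'
  have "tensor_map n m n2 m2 \<Phi> \<Omega> \<rho> $$ (a * m2 + b, a' * m2 + b')
      = (\<Sum>i<n. \<Sum>j<n. \<Sum>y<n2. \<Sum>y'<n2. \<Sum>k<K. R k $$ (a, a') * (X k $$ (j, i) * \<rho> $$ (i * n2 + y, j * n2 + y') * U y y'))"
    unfolding tensor_map_index[OF linear \<Omega> i]
    by (intro sum.cong refl) (simp add: \<Phi>_munit i U_def sum_distrib_left sum_distrib_right mult_ac)
  also have "\<dots> = (\<Sum>k<K. \<Sum>i<n. \<Sum>j<n. \<Sum>y<n2. \<Sum>y'<n2. R k $$ (a, a') * (X k $$ (j, i) * \<rho> $$ (i * n2 + y, j * n2 + y') * U y y'))"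
    by (simp only: sum_rotate[of _ "{..<K}"])
  also have "\<dots> = (\<Sum>k<K. \<Sum>y<n2. \<Sum>y'<n2. \<Sum>i<n. \<Sum>j<n. R k $$ (a, a') * (X k $$ (j, i) * \<rho> $$ (i * n2 + y, j * n2 + y') * U y y'))"
    by (rule sum.cong[OF refl], rule trans[OF sum_rotate], rule sum.cong[OF refl], rule sum_rotate)
  also have "\<dots> = (\<Sum>k<K. R k $$ (a, a') * (\<Sum>y<n2. \<Sum>y'<n2. slice_trace n n2 (X k) \<rho> $$ (y, y') * U y y'))"
    by (simp add: slice_trace_def sum_distrib_left sum_distrib_right mult_ac)
  also have "\<dots> = (\<Sum>k<K. kron (R k) (\<Omega> (slice_trace n n2 (X k) \<rho>)) $$ (a * m2 + b, a' * m2 + b'))"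
    by (intro sum.cong refl)
       (simp add: kron_index[OF density_carrier[OF R] linear_mmap_carrier[OF \<Omega> G] i] U_def
         linear_mmap_expand[OF \<Omega> G i(3,4)])
  finally show "tensor_map n m n2 m2 \<Phi> \<Omega> \<rho> $$ (a * m2 + b, a' * m2 + b')
    = mat (m * m2) (m * m2) (\<lambda>ij. \<Sum>k<K. kron (R k) (\<Omega> (slice_trace n n2 (X k) \<rho>)) $$ ij) $$ (a * m2 + b, a' * m2 + b')"
    using i by (simp add: prod_index_less)
qed simp

text \<open>Once the probabilities are attached to the \<open>R k\<close>, the first factors sum to
  the output of \<open>\<Phi>\<close> on the marginal, the second factors are outputs of
  \<open>\<Omega>\<close> on states, and \<open>schatten_separable_le\<close> applies.\<close>

lemma schatten_tensor_map_le:
  assumes \<Omega>: "channel n2 m2 \<Omega>" and n: "0 < n" "0 < n2" and p: "1 \<le> p" and \<rho>: "density (n * n2) \<rho>"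
  shows "schatten p (tensor_map n m n2 m2 \<Phi> \<Omega> \<rho>) \<le> max_p_norm p n \<Phi> * max_p_norm p n2 \<Omega>"
proof -
  have lin: "linear_mmap n2 m2 \<Omega>" using \<Omega> by (simp add: channel_def)
  have dm: "density_map n2 m2 \<Omega>" by (rule channel_density_map[OF \<Omega>])
  let ?r = "ptrace n n2 \<rho>"
  have r: "density n ?r" by (rule ptrace_density[OF \<rho>])
  have "\<exists>x \<tau>. 0 \<le> x \<and> mtrace (X k * ?r) = of_real x \<and> density n2 \<tau>
      \<and> slice_trace n n2 (X k) \<rho> = of_real x \<cdot>\<^sub>m \<tau>" if k: "k < K" for k
  proof -
    obtain x where x: "0 \<le> x" "mtrace (X k * ?r) = of_real x"
      using psd_mtrace_mult[OF X[OF k]] r unfolding density_def by blast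
    then have "mtrace (slice_trace n n2 (X k) \<rho>) = of_real x"
      using slice_trace_mtrace[OF psd_carrier[OF X[OF k]]] by simp
    from psd_normalize[OF slice_trace_psd[OF X[OF k]] n(2) this] \<rho> x show ?thesis
      by (auto simp: density_def)
  qed
  then obtain x \<tau> where x: "\<And>k. k < K \<Longrightarrow> 0 \<le> x k" "\<And>k. k < K \<Longrightarrow> mtrace (X k * ?r) = of_real (x k)"
    and \<tau>: "\<And>k. k < K \<Longrightarrow> density n2 (\<tau> k)"
      "\<And>k. k < K \<Longrightarrow> slice_trace n n2 (X k) \<rho> = of_real (x k) \<cdot>\<^sub>m \<tau> k" by metis
  have \<tau>C: "\<tau> k \<in> carrier_mat n2 n2" if "k < K" for k using \<tau>(1)[OF that] by (rule density_carrier)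
  have RC: "R k \<in> carrier_mat m m" if "k < K" for k using R[OF that] by (rule density_carrier)
  let ?R = "\<lambda>k. of_real (x k) \<cdot>\<^sub>m R k"
  \<comment> \<open>Linearity of \<open>\<Omega>\<close> moves the probability \<open>x k\<close>
    from the second tensor factor to the first.\<close>
  have "kron (R k) (\<Omega> (slice_trace n n2 (X k) \<rho>)) = kron (?R k) (\<Omega> (\<tau> k))" if k: "k < K" for k
  proof -
    have "\<Omega> (slice_trace n n2 (X k) \<rho>) = of_real (x k) \<cdot>\<^sub>m \<Omega> (\<tau> k)"
      unfolding \<tau>(2)[OF k] using lin \<tau>C[OF k] by (simp add: linear_mmap_def)
    then show ?thesis using RC[OF k] linear_mmap_carrier[OF lin \<tau>C[OF k]] prod_index_div_mod
      by (intro eq_matI) (auto simp: kron_def)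
  qed
  then have T: "tensor_map n m n2 m2 \<Phi> \<Omega> \<rho>
      = mat (m * m2) (m * m2) (\<lambda>ij. \<Sum>k<K. kron (?R k) (\<Omega> (\<tau> k)) $$ ij)"
    unfolding tensor_map_eq[OF lin] by (intro eq_matI) auto
  have S: "\<Phi> ?r = mat m m (\<lambda>ij. \<Sum>k<K. ?R k $$ ij)"
    unfolding \<Phi>[OF density_carrier[OF r]]
    by (intro eq_matI) (auto simp: x(2) carrier_matD[OF RC] mult.commute intro!: sum.cong)
  have \<nu>0: "0 \<le> max_p_norm p n2 \<Omega>" by (rule max_p_norm_nonneg[OF dm n(2) p])
  have "schatten p (tensor_map n m n2 m2 \<Phi> \<Omega> \<rho>) \<le> schatten p (\<Phi> ?r) * max_p_norm p n2 \<Omega>"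
    unfolding T S
  proof (rule schatten_separable_le[OF _ _ _ \<nu>0 p])
    fix k assume k: "k < K"
    show "psd m (?R k)" using R[OF k] x(1)[OF k] by (intro psd_smult) (simp_all add: density_def)
    show "psd m2 (\<Omega> (\<tau> k))" using dm \<tau>(1)[OF k] by (simp add: density_map_def density_def)
    show "schatten p (\<Omega> (\<tau> k)) \<le> max_p_norm p n2 \<Omega>"
      by (rule schatten_le_max_p_norm[OF dm \<tau>(1)[OF k] p])
  qed
  also have "\<dots> \<le> max_p_norm p n \<Phi> * max_p_norm p n2 \<Omega>"
    by (intro mult_right_mono \<nu>0 schatten_le_max_p_norm[OF density_map r p])
  finally show ?thesis .
qed

text \<open>The upper bound holds state by state; product inputs, on which the norm factors, give
  the reverse inequality after taking suprema in each factor separately.\<close>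

lemma max_p_norm_tensor_map:
  assumes \<Omega>: "channel n2 m2 \<Omega>" and n: "0 < n" "0 < n2" and p: "1 \<le> p"
  shows "max_p_norm p (n * n2) (tensor_map n m n2 m2 \<Phi> \<Omega>) = max_p_norm p n \<Phi> * max_p_norm p n2 \<Omega>"
proof (rule antisym)
  let ?T = "tensor_map n m n2 m2 \<Phi> \<Omega>"
  have lin: "linear_mmap n2 m2 \<Omega>" using \<Omega> by (simp add: channel_def)
  have dm: "density_map n2 m2 \<Omega>" by (rule channel_density_map[OF \<Omega>])
  obtain \<rho>0 where "density (n * n2) \<rho>0" using density_exists[of "n * n2"] n by auto
  then show "max_p_norm p (n * n2) ?T \<le> max_p_norm p n \<Phi> * max_p_norm p n2 \<Omega>"
    unfolding max_p_norm_def[of p "n * n2"]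
    by (intro cSUP_least) (auto intro: schatten_tensor_map_le[OF \<Omega> n p])
  \<comment> \<open>The estimate on single states doubles as the boundedness that
    \<open>cSUP_upper\<close> requires.\<close>
  have bdd: "bdd_above ((\<lambda>\<rho>. schatten p (?T \<rho>)) ` {\<rho>. density (n * n2) \<rho>})"
    using schatten_tensor_map_le[OF \<Omega> n p] by (intro bdd_aboveI2) auto
  have prod: "schatten p (\<Phi> \<rho>) * schatten p (\<Omega> \<sigma>) \<le> max_p_norm p (n * n2) ?T"
    if \<rho>: "density n \<rho>" and \<sigma>: "density n2 \<sigma>" for \<rho> \<sigma>
  proof -
    have "psd m (\<Phi> \<rho>)" "psd m2 (\<Omega> \<sigma>)"
      using density_map dm \<rho> \<sigma> by (auto simp: density_map_def density_def)
    then have "schatten p (\<Phi> \<rho>) * schatten p (\<Omega> \<sigma>) = schatten p (?T (kron \<rho> \<sigma>))"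
      using tensor_map_kron[OF linear lin density_carrier[OF \<rho>] density_carrier[OF \<sigma>]]
      by (simp add: schatten_kron)
    also have "\<dots> \<le> max_p_norm p (n * n2) ?T"
      unfolding max_p_norm_def using kron_density[OF \<rho> \<sigma>] by (intro cSUP_upper bdd) simp
    finally show ?thesis .
  qed
  define N where "N = max_p_norm p (n * n2) ?T"
  have N0: "0 \<le> N" 
    using prod density_exists[OF n(1)] density_exists[OF n(2)] schatten_nonneg
    unfolding N_def by (meson mult_nonneg_nonneg order_trans)
  have ne: "{\<rho>. density n \<rho>} \<noteq> {}" "{\<rho>. density n2 \<rho>} \<noteq> {}"
    using density_exists n by auto
  \<comment> \<open>The supremum over states of the second system is taken after dividing by the
    first norm, so a vanishing norm is treated apart, using \<open>0 \<le> N\<close>.\<close>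
  have step: "schatten p (\<Phi> \<rho>) * max_p_norm p n2 \<Omega> \<le> N" if \<rho>: "density n \<rho>" for \<rho>
  proof (cases "schatten p (\<Phi> \<rho>) = 0")
    case False
    then have pos: "0 < schatten p (\<Phi> \<rho>)" using schatten_nonneg[of p "\<Phi> \<rho>"] by simp
    have "max_p_norm p n2 \<Omega> \<le> N / schatten p (\<Phi> \<rho>)"
      unfolding max_p_norm_def[of p n2] using prod[OF \<rho>] pos ne
      by (intro cSUP_least) (auto simp: field_simps N_def)
    then show ?thesis using pos by (simp add: field_simps)
  qed (use N0 in simp)
  have "max_p_norm p n \<Phi> * max_p_norm p n2 \<Omega> \<le> N"
  proof (cases "max_p_norm p n2 \<Omega> = 0")
    case False
    then have pos: "0 < max_p_norm p n2 \<Omega>" using max_p_norm_nonneg[OF dm n(2) p] by simp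
    have "max_p_norm p n \<Phi> \<le> N / max_p_norm p n2 \<Omega>"
      unfolding max_p_norm_def[of p n] using step pos ne
      by (intro cSUP_least) (auto simp: field_simps)
    then show ?thesis using pos by (simp add: field_simps)
  qed (use N0 in simp)
  then show "max_p_norm p n \<Phi> * max_p_norm p n2 \<Omega> \<le> max_p_norm p (n * n2) ?T"
    by (simp add: N_def)
qed

end

theorem theorem1:
  fixes p :: real and n1 m1 n2 m2 :: nat
    and \<Phi> \<Omega> :: "complex mat \<Rightarrow> complex mat"
  assumes "p \<ge> 1" and "0 < n1" and "0 < n2"
    and "eb_channel n1 m1 \<Phi>"
    and "channel n2 m2 \<Omega>"
  shows "max_p_norm p (n1 * n2) (tensor_map n1 m1 n2 m2 \<Phi> \<Omega>)
         = max_p_norm p n1 \<Phi> * max_p_norm p n2 \<Omega>"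
proof -
  obtain K R X where "eb_map n1 m1 \<Phi> K R X"
    using assms(4) unfolding eb_channel_def eb_map_def by blast
  then show ?thesis using assms by (intro eb_map.max_p_norm_tensor_map)
qed

end
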